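(* Define the integers $a_n$ ($n\ge0$) by the expansion \[ f(z)=\prod_{n=1}^{\infty}\big(1-e^{2\pi i n z}\big)=\sum_{n=0}^{\infty}a_n e^{2\pi i n z},\qquad \operatorname{Im} z>0, \] and for $s>0$ let \[ m_{s,f}(x)=\sum_{n=1}^{\infty}\frac{a_n e^{-2\pi i n x}}{n^s},\qquad x\in[0,1]. \] If $1/4<s<1/2$, then $m_{s,f}$ belongs to weak-type $L^{2/(1-2s)}[0,1]$; that is, there is a constant $c$ such that $|\{x\in[0,1]:|m_{s,f}(x)|>\alpha\}|\le c\,\alpha^{-2/(1-2s)}$ for all $\alpha>0$.
   Context: By Euler's pentagonal number theorem, $a_n\in\{0,\pm1\}$ and $a_n\ne0$ only when $n=(3k^2+k)/2$ for some $k\in\mathbb{Z}$; hence for $s>1/4$ the coefficients $a_n n^{-s}$ are square-summable and the series defining $m_{s,f}$ converges in $L^2[0,1]$. A function $g$ on $[0,1]$ is of weak-type $L^r[0,1]$ ($r>0$) if $|\{x\in[0,1]:|g(x)|>\alpha\}|\le c\,\alpha^{-r}$ for all $\alpha>0$, with $c$ independent of $\alpha$. *)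

theory Defs
  imports "HOL-Analysis.Analysis" "HOL-Computational_Algebra.Polynomial"
begin

text \<open>Coefficients of the q-expansion of prod_{k>=1} (1 - q^k): the coefficient a_n
  of q^n equals the coefficient of X^n in the finite product prod_{k=1}^{n} (1 - X^k),
  since the factors with k > n do not affect coefficients of degree <= n.\<close>
definition eta_coeff :: "nat \<Rightarrow> int" where
  "eta_coeff n = coeff (\<Prod>k\<in>{1..n}. (1 - monom 1 k :: int poly)) n"

definition m_partial :: "real \<Rightarrow> nat \<Rightarrow> real \<Rightarrow> complex" where
  "m_partial s N x = (\<Sum>n\<in>{1..N}. of_int (eta_coeff n) * exp (- 2 * pi * \<i> * of_nat n * of_real x)
                                    / of_real (real n powr s))"

text \<open>g is (a representative of) the L^2[0,1]-limit of the partial sums, i.e. m_{s,f}.\<close>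
definition is_m_sf :: "real \<Rightarrow> (real \<Rightarrow> complex) \<Rightarrow> bool" where
  "is_m_sf s g \<longleftrightarrow> g \<in> borel_measurable lborel \<and>
     ((\<lambda>N. \<integral>\<^sup>+ x\<in>{0..1}. ennreal ((cmod (m_partial s N x - g x))\<^sup>2) \<partial>lborel) \<longlonglongrightarrow> 0)"

definition weak_type_L :: "real \<Rightarrow> (real \<Rightarrow> complex) \<Rightarrow> bool" where
  "weak_type_L r g \<longleftrightarrow> (\<exists>c. \<forall>\<alpha>>0.
     emeasure lborel {x\<in>{0..1}. cmod (g x) > \<alpha>} \<le> ennreal (c * \<alpha> powr (- r)))"

end

theory Submission
  imports Defs "HOL-Complex_Analysis.Complex_Analysis"
begin

text \<open>
  For \<open>s > 1/4\<close> the function \<open>m\<^bsub>s,f\<^esub>\<close> is even bounded, because \<open>f\<close> is up to an exponential factor the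
  Dedekind eta function, a cusp form of weight 1/2. Indeed \<open>Im z * \<bar>\<eta>(z)\<bar>\<^sup>4\<close> is invariant under
  \<open>z \<mapsto> z + 1\<close> and \<open>z \<mapsto> -1/z\<close>, and every point of the upper half plane is moved by these maps to
  one with \<open>Im z \<ge> 1/2\<close>, where the quantity is bounded. Hence \<open>\<bar>f(x + iy)\<bar> \<le> C y\<^bsup>-1/4\<^esup>\<close> for small
  \<open>y\<close>, and the Mellin integral
  \<open>\<Gamma>(s) m\<^bsub>s,f\<^esub>(x) = \<integral> (f(-x + it/2\<pi>) - 1) t\<^bsup>s-1\<^esup> dt\<close> converges absolutely and uniformly in \<open>x\<close>.
  It represents the \<open>L\<^sup>2\<close> limit of the partial sums by Cauchy--Schwarz, Bessel's inequality and
  dominated convergence.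

  For \<open>z = iy\<close> the inversion formula is a statement on
  \<open>-ln f(iy) = \<Sum>\<^sub>m 1 / (m (e\<^bsup>2\<pi>my\<^esup> - 1))\<close>. Expanding each term by the partial fractions of \<open>coth\<close>
  gives the conditionally convergent double series of \<open>y / (m\<^sup>2 y\<^sup>2 + k\<^sup>2)\<close>, and \<open>y \<mapsto> 1/y\<close> exchanges
  the order of summation. The identity theorem then extends the formula to the half plane.
\<close>

section \<open>The Euler product as a power series\<close>

text \<open>The number of factors is decoupled from the coefficient index, which
  \<open>eta_coeff\<close> ties together, so that one can induct on \<open>N\<close> with the index
  fixed.\<close>

definition eta_poly :: "nat \<Rightarrow> int poly" where
  "eta_poly N = (\<Prod>k\<in>{1..N}. 1 - monom 1 k)"

lemma coeff_eta_poly_Suc: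
  "coeff (eta_poly (Suc N)) n =
     coeff (eta_poly N) n - (if n < Suc N then 0 else coeff (eta_poly N) (n - Suc N))"
proof -
  have "eta_poly (Suc N) = eta_poly N - monom 1 (Suc N) * eta_poly N"
    by (simp add: eta_poly_def algebra_simps)
  thus ?thesis by (simp add: coeff_monom_mult del: monom_Suc)
qed

text \<open>The factor with exponent N + 1 only touches degrees above N, so the coefficient of
  degree \<open>n\<close> is final once \<open>N\<close> reaches \<open>n\<close>.\<close>

lemma coeff_eta_poly:
  assumes "n \<le> N"
  shows "coeff (eta_poly N) n = eta_coeff n"
  using assms
proof (induction N rule: dec_induct)
  case base
  show ?case by (simp add: eta_coeff_def eta_poly_def)
next
  case (step N)
  thus ?case by (simp add: coeff_eta_poly_Suc)
qed

lemma sums_shift_right: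
  fixes f :: "nat \<Rightarrow> 'a :: real_normed_vector"
  assumes "f sums s"
  shows "(\<lambda>n. if n < k then 0 else f (n - k)) sums s"
proof -
  have "(\<lambda>n. (if n + k < k then 0 else f (n + k - k))) sums s" using assms by simp
  hence "(\<lambda>n. if n < k then 0 else f (n - k)) sums
           (s + (\<Sum>n<k. if n < k then 0 else f (n - k)))"
    by (subst (asm) sums_iff_shift) 
  moreover have "(\<Sum>n<k. if n < k then 0 else f (n - k)) = 0"
    by (intro sum.neutral) auto
  ultimately show ?thesis by simp
qed

lemma eta_poly_sums:
  fixes q :: complex
  shows "(\<lambda>n. of_int (coeff (eta_poly N) n) * q ^ n) sums (\<Prod>k\<in>{1..N}. 1 - q ^ k)"
proof (induction N)
  case 0
  have "(\<lambda>n. of_int (coeff (eta_poly 0) n) * q ^ n) = (\<lambda>n. if n = 0 then 1 else 0)"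
    by (auto simp: eta_poly_def fun_eq_iff coeff_1)
  thus ?case using sums_single[of 0 "\<lambda>_. 1::complex"] by simp
next
  case (Suc N)
  let ?f = "\<lambda>n. of_int (coeff (eta_poly N) n) * q ^ n"
  let ?s = "\<Prod>k\<in>{1..N}. 1 - q ^ k"
  have "(\<lambda>n. ?f n - q ^ Suc N * (if n < Suc N then 0 else ?f (n - Suc N))) sums (?s - q ^ Suc N * ?s)"
    by (intro sums_diff sums_mult sums_shift_right Suc)
  moreover have "?f n - q ^ Suc N * (if n < Suc N then 0 else ?f (n - Suc N))
      = of_int (coeff (eta_poly (Suc N)) n) * q ^ n" for n
  proof (cases "n < Suc N")
    case True
    thus ?thesis by (simp add: coeff_eta_poly_Suc)
  next
    case False
    hence "q ^ Suc N * q ^ (n - Suc N) = q ^ n" by (metis le_add_diff_inverse not_less power_add)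
    thus ?thesis using False by (simp add: coeff_eta_poly_Suc left_diff_distrib mult.left_commute mult.assoc)
  qed
  moreover have "?s - q ^ Suc N * ?s = (\<Prod>k\<in>{1..Suc N}. 1 - q ^ k)"
    by (simp add: left_diff_distrib mult.commute)
  ultimately show ?case by simp
qed

lemma prod_one_plus_power_le:
  fixes r :: real
  assumes "0 \<le> r" "r < 1"
  shows "(\<Prod>k\<in>{1..N}. 1 + r ^ k) \<le> exp (1 / (1 - r))"
proof -
  have "(\<Prod>k\<in>{1..N}. 1 + r ^ k) \<le> (\<Prod>k\<in>{1..N}. exp (r ^ k))"
    using assms by (intro prod_mono) (auto simp: add_nonneg_nonneg)
  also have "\<dots> = exp (\<Sum>k\<in>{1..N}. r ^ k)" by (simp add: exp_sum)
  also have "(\<Sum>k\<in>{1..N}. r ^ k) \<le> (\<Sum>k. r ^ k)"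
    using assms by (intro sum_le_suminf) (auto simp: summable_geometric)
  also have "\<dots> = 1 / (1 - r)" using assms by (simp add: suminf_geometric)
  finally show ?thesis by simp
qed

text \<open>Replacing each factor 1 - X^k by 1 + X^k dominates all coefficients in absolute value,
  and 1 + u is at most exp u. The bound is uniform in both \<open>D\<close> and \<open>N\<close>, so
  it passes to the limit coefficients \<open>eta_coeff\<close> and to the full series.\<close>

lemma sum_abs_coeff_eta_poly_le:
  fixes r :: real
  assumes "0 \<le> r" "r < 1"
  shows "(\<Sum>n<D. \<bar>of_int (coeff (eta_poly N) n)\<bar> * r ^ n) \<le> exp (1 / (1 - r))"
proof -
  have "(\<Sum>n<D. \<bar>of_int (coeff (eta_poly N) n)\<bar> * r ^ n) \<le> (\<Prod>k\<in>{1..N}. 1 + r ^ k)"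
  proof (induction N)
    case 0
    have "(\<Sum>n<D. \<bar>of_int (coeff (eta_poly 0) n)\<bar> * r ^ n) = (\<Sum>n<D. if n = 0 then 1 else 0)"
      by (intro sum.cong) (auto simp: eta_poly_def coeff_1)
    also have "\<dots> \<le> 1" by (simp add: sum.delta')
    finally show ?case by simp
  next
    case (Suc N)
    let ?f = "\<lambda>n. \<bar>of_int (coeff (eta_poly N) n)\<bar> * r ^ n :: real"
    let ?g = "\<lambda>n. if n < Suc N then 0 else ?f (n - Suc N)"
    have "(\<Sum>n<D. \<bar>of_int (coeff (eta_poly (Suc N)) n)\<bar> * r ^ n)
       \<le> (\<Sum>n<D. ?f n + r ^ Suc N * ?g n)"
    proof (rule sum_mono)
      fix n
      show "\<bar>of_int (coeff (eta_poly (Suc N)) n)\<bar> * r ^ n \<le> ?f n + r ^ Suc N * ?g n"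
      proof (cases "n < Suc N")
        case True
        thus ?thesis by (simp add: coeff_eta_poly_Suc)
      next
        case False
        hence "r ^ n = r ^ Suc N * r ^ (n - Suc N)" by (metis le_add_diff_inverse not_less power_add)
        hence "r ^ Suc N * ?g n = \<bar>of_int (coeff (eta_poly N) (n - Suc N))\<bar> * r ^ n"
          using False by simp
        moreover have "\<bar>of_int (coeff (eta_poly (Suc N)) n)\<bar> \<le> \<bar>of_int (coeff (eta_poly N) n)\<bar>
            + (\<bar>of_int (coeff (eta_poly N) (n - Suc N))\<bar> :: real)"
          using False by (simp add: coeff_eta_poly_Suc)
        ultimately show ?thesis using assms
          by (simp add: mult_right_mono flip: distrib_right)
      qed
    qed
    also have "\<dots> = (\<Sum>n<D. ?f n) + r ^ Suc N * (\<Sum>n<D. ?g n)"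
      by (simp add: sum.distrib sum_distrib_left)
    also have "(\<Sum>n<D. ?g n) = (\<Sum>n\<in>{Suc N..<D}. ?f (n - Suc N))"
      by (intro sum.mono_neutral_cong_right) auto
    also have "\<dots> = (\<Sum>n\<in>{..<D - Suc N}. ?f n)"
      by (intro sum.reindex_bij_witness[of _ "\<lambda>n. n + Suc N" "\<lambda>n. n - Suc N"]) auto
    also have "\<dots> \<le> (\<Sum>n<D. ?f n)"
      using assms by (intro sum_mono2) auto
    also have "(\<Sum>n<D. ?f n) + r ^ Suc N * (\<Sum>n<D. ?f n) = (1 + r ^ Suc N) * (\<Sum>n<D. ?f n)"
      by (simp add: algebra_simps)
    also have "\<dots> \<le> (1 + r ^ Suc N) * (\<Prod>k\<in>{1..N}. 1 + r ^ k)"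
      using assms by (intro mult_left_mono Suc) auto
    also have "\<dots> = (\<Prod>k\<in>{1..Suc N}. 1 + r ^ k)" by (simp add: mult_ac)
    finally show ?case using assms by (simp add: mult_left_mono)
  qed
  also have "\<dots> \<le> exp (1 / (1 - r))" using assms by (rule prod_one_plus_power_le)
  finally show ?thesis .
qed

lemma summable_abs_eta_coeff:
  fixes r :: real
  assumes "0 \<le> r" "r < 1"
  shows "summable (\<lambda>n. \<bar>of_int (eta_coeff n)\<bar> * r ^ n)"
    and "(\<Sum>n. \<bar>of_int (eta_coeff n)\<bar> * r ^ n) \<le> exp (1 / (1 - r))"
proof -
  have *: "(\<Sum>n<D. \<bar>of_int (eta_coeff n)\<bar> * r ^ n) \<le> exp (1 / (1 - r))" for D
  proof -
    have "(\<Sum>n<D. \<bar>of_int (eta_coeff n)\<bar> * r ^ n) = (\<Sum>n<D. \<bar>of_int (coeff (eta_poly D) n)\<bar> * r ^ n)"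
      by (intro sum.cong) (auto simp: coeff_eta_poly)
    thus ?thesis using sum_abs_coeff_eta_poly_le[OF assms] by metis
  qed
  show "summable (\<lambda>n. \<bar>of_int (eta_coeff n)\<bar> * r ^ n)"
    using assms * by (intro bounded_imp_summable[where B = "exp (1 / (1 - r))"]) (auto simp flip: lessThan_Suc_atMost simp del: sum.lessThan_Suc)
  thus "(\<Sum>n. \<bar>of_int (eta_coeff n)\<bar> * r ^ n) \<le> exp (1 / (1 - r))"
    using * by (intro suminf_le_const)
qed

text \<open>The infinite product of the 1 - q^k in the unit disc (see \<open>euler_product\<close>),
  encoded by its power series, from which holomorphy and measurability can be read off.\<close>

definition euler_fun :: "complex \<Rightarrow> complex" where
  "euler_fun q = (\<Sum>n. of_int (eta_coeff n) * q ^ n)"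

lemma euler_fun_sums:
  assumes "norm q < 1"
  shows "(\<lambda>n. of_int (eta_coeff n) * q ^ n) sums euler_fun q"
proof -
  have "summable (\<lambda>n. norm (of_int (eta_coeff n) * q ^ n))"
    using summable_abs_eta_coeff(1)[of "norm q"] assms by (simp add: norm_mult norm_power)
  thus ?thesis unfolding euler_fun_def by (rule summable_sums[OF summable_norm_cancel])
qed

text \<open>The N-th partial product and the limit series agree in degrees up to N. In higher
  degrees, comparing |q| = r with a radius R between r and 1 gains a factor (r/R)^N over the uniform
  majorant at R.\<close>

lemma euler_product:
  assumes "norm q < 1"
  shows "(\<lambda>N. \<Prod>k\<in>{1..N}. 1 - q ^ k) \<longlonglongrightarrow> euler_fun q"
proof (cases "q = 0")
  case True
  have "euler_fun q = of_int (eta_coeff 0)"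
    unfolding euler_fun_def True by (rule powser_zero)
  moreover have "(\<Prod>k\<in>{1..N}. 1 - q ^ k) = 1" for N
    using True by (intro prod.neutral) auto
  ultimately show ?thesis by (simp add: eta_coeff_def)
next
  case False
  define r where "r = norm q"
  obtain R where R: "r < R" "R < 1" using assms dense unfolding r_def by blast
  have r: "r > 0" using False by (simp add: r_def)
  let ?B = "2 * exp (1 / (1 - R))"
  have bd: "norm ((\<Prod>k\<in>{1..N}. 1 - q ^ k) - euler_fun q) \<le> (r / R) ^ N * ?B" for N
  proof -
    define d where "d n = of_int (coeff (eta_poly N) n) * q ^ n - of_int (eta_coeff n) * q ^ n" for n
    have d: "d sums ((\<Prod>k\<in>{1..N}. 1 - q ^ k) - euler_fun q)"
      unfolding d_def by (intro sums_diff eta_poly_sums euler_fun_sums assms)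
    have le: "norm (d n) \<le> (r / R) ^ N * ((\<bar>of_int (coeff (eta_poly N) n)\<bar> * R ^ n) + (\<bar>of_int (eta_coeff n)\<bar> * R ^ n))" for n
    proof (cases "n \<le> N")
      case True
      thus ?thesis using r R by (simp add: d_def coeff_eta_poly)
    next
      case False
      have "norm (d n) \<le> (\<bar>of_int (coeff (eta_poly N) n)\<bar> + \<bar>of_int (eta_coeff n)\<bar>) * r ^ n"
      proof -
        have "norm (d n) \<le> norm (of_int (coeff (eta_poly N) n) * q ^ n) + norm (of_int (eta_coeff n) * q ^ n)"
          unfolding d_def by (rule norm_triangle_ineq4)
        thus ?thesis by (simp add: norm_mult norm_power r_def algebra_simps)
      qed
      moreover have "r ^ n \<le> (r / R) ^ N * R ^ n"
      proof -
        have "r ^ n = (r / R) ^ n * R ^ n" using R r by (simp add: power_divide)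
        also have "\<dots> \<le> (r / R) ^ N * R ^ n"
          using False r R by (intro mult_right_mono power_decreasing) auto
        finally show ?thesis .
      qed
      ultimately have "norm (d n) \<le> (\<bar>of_int (coeff (eta_poly N) n)\<bar> + \<bar>of_int (eta_coeff n)\<bar>) * ((r / R) ^ N * R ^ n)"
        by (meson order_trans mult_left_mono add_nonneg_nonneg abs_ge_zero)
      thus ?thesis by (simp add: algebra_simps)
    qed
    have "norm (\<Sum>n<D. d n) \<le> (r / R) ^ N * ?B" for D
    proof -
      have "norm (\<Sum>n<D. d n) \<le> (\<Sum>n<D. (r / R) ^ N * ((\<bar>of_int (coeff (eta_poly N) n)\<bar> * R ^ n) + (\<bar>of_int (eta_coeff n)\<bar> * R ^ n)))"
        by (rule order.trans[OF norm_sum sum_mono[OF le]])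
      also have "\<dots> = (r / R) ^ N * ((\<Sum>n<D. \<bar>of_int (coeff (eta_poly N) n)\<bar> * R ^ n) + (\<Sum>n<D. \<bar>of_int (eta_coeff n)\<bar> * R ^ n))"
        by (simp only: sum.distrib[symmetric] sum_distrib_left[symmetric])
      also have "\<dots> \<le> (r / R) ^ N * (exp (1 / (1 - R)) + exp (1 / (1 - R)))"
      proof (intro mult_left_mono add_mono)
        show "(\<Sum>n<D. \<bar>of_int (coeff (eta_poly N) n)\<bar> * R ^ n) \<le> exp (1 / (1 - R))"
          using r R by (intro sum_abs_coeff_eta_poly_le) auto
        have "(\<Sum>n<D. \<bar>of_int (eta_coeff n)\<bar> * R ^ n) \<le> (\<Sum>n. \<bar>of_int (eta_coeff n)\<bar> * R ^ n)"
          using r R by (intro sum_le_suminf summable_abs_eta_coeff) auto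
        also have "\<dots> \<le> exp (1 / (1 - R))"
          using r R by (intro summable_abs_eta_coeff(2)) auto
        finally show "(\<Sum>n<D. \<bar>of_int (eta_coeff n)\<bar> * R ^ n) \<le> exp (1 / (1 - R))" .
      qed (use r R in auto)
      finally show ?thesis by simp
    qed
    thus ?thesis
      using d by (intro Lim_bounded[where M = 0 and f = "\<lambda>D. norm (\<Sum>n<D. d n)"] tendsto_norm) (auto simp: sums_def)
  qed
  have "(\<lambda>N. (\<Prod>k\<in>{1..N}. 1 - q ^ k) - euler_fun q) \<longlonglongrightarrow> 0"
  proof (rule Lim_null_comparison)
    have "(\<lambda>N. (r / R) ^ N * ?B) \<longlonglongrightarrow> 0 * ?B"
      using r R by (intro tendsto_mult LIMSEQ_realpow_zero tendsto_const) auto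
    thus "(\<lambda>N. (r / R) ^ N * ?B) \<longlonglongrightarrow> 0" by simp
  qed (use bd in auto)
  thus ?thesis by (rule LIM_zero_cancel)
qed

section \<open>Size estimates for the Euler product in the unit disc\<close>

lemma norm_euler_fun_le:
  assumes "norm q \<le> r" "r < 1"
  shows "norm (euler_fun q) \<le> exp (1 / (1 - r))"
proof (rule Lim_bounded[where M = 0])
  show "(\<lambda>N. norm (\<Prod>k\<in>{1..N}. 1 - q ^ k)) \<longlonglongrightarrow> norm (euler_fun q)"
    using assms by (intro tendsto_norm euler_product) auto
  have r: "0 \<le> r" using assms norm_ge_zero order_trans by blast
  have "norm (\<Prod>k\<in>{1..N}. 1 - q ^ k) \<le> exp (1 / (1 - r))" for N
  proof -
    have "norm (\<Prod>k\<in>{1..N}. 1 - q ^ k) \<le> (\<Prod>k\<in>{1..N}. 1 + r ^ k)"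
      unfolding prod_norm[symmetric]
    proof (intro prod_mono conjI)
      fix k
      have "norm (1 - q ^ k) \<le> 1 + norm q ^ k"
        using norm_triangle_ineq4[of 1 "q ^ k"] by (simp add: norm_power)
      also have "\<dots> \<le> 1 + r ^ k" using assms by (simp add: power_mono)
      finally show "norm (1 - q ^ k) \<le> 1 + r ^ k" .
    qed auto
    also have "\<dots> \<le> exp (1 / (1 - r))" using r assms by (intro prod_one_plus_power_le) auto
    finally show ?thesis .
  qed
  thus "\<forall>n\<ge>0. norm (\<Prod>k\<in>{1..n}. 1 - q ^ k) \<le> exp (1 / (1 - r))" by simp
qed

text \<open>The constant coefficient is 1, so the difference vanishes to first order at q = 0. The
  extra factor \<open>norm q\<close> becomes the exponential decay for large t in
  \<open>euler_fun_bound\<close>.\<close>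

lemma norm_euler_fun_minus_one_le:
  assumes "norm q \<le> r" "r < 1" "0 < r"
  shows "norm (euler_fun q - 1) \<le> norm q * (exp (1 / (1 - r)) / r)"
proof -
  let ?c = "\<lambda>n. of_int (eta_coeff n)"
  have q: "norm q < 1" using assms by simp
  have "(\<lambda>n. ?c (Suc n) * q ^ Suc n) sums (euler_fun q - 1)"
    using euler_fun_sums[OF q] by (subst sums_Suc_iff) (simp add: eta_coeff_def)
  moreover have "norm (\<Sum>n<D. ?c (Suc n) * q ^ Suc n) \<le> norm q * (exp (1 / (1 - r)) / r)" for D
  proof -
    have "norm (\<Sum>n<D. ?c (Suc n) * q ^ Suc n) \<le> (\<Sum>n<D. norm q / r * (\<bar>?c (Suc n)\<bar> * r ^ Suc n))"
    proof (rule sum_norm_le)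
      fix n
      have "norm q ^ Suc n \<le> norm q / r * r ^ Suc n"
        using assms by (simp add: mult_left_mono power_mono)
      hence "\<bar>?c (Suc n)\<bar> * norm q ^ Suc n \<le> \<bar>?c (Suc n)\<bar> * (norm q / r * r ^ Suc n)"
        by (intro mult_left_mono) auto
      thus "norm (?c (Suc n) * q ^ Suc n) \<le> norm q / r * (\<bar>?c (Suc n)\<bar> * r ^ Suc n)"
        by (simp only: norm_mult norm_power mult_ac norm_of_int)
    qed
    also have "\<dots> = norm q / r * (\<Sum>n<D. \<bar>?c (Suc n)\<bar> * r ^ Suc n)"
      by (simp add: sum_distrib_left)
    also have "(\<Sum>n<D. \<bar>?c (Suc n)\<bar> * r ^ Suc n) \<le> (\<Sum>n<Suc D. \<bar>?c n\<bar> * r ^ n)"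
      unfolding sum.lessThan_Suc_shift by simp
    also have "\<dots> \<le> (\<Sum>n. \<bar>?c n\<bar> * r ^ n)"
      using assms by (intro sum_le_suminf summable_abs_eta_coeff) auto
    also have "\<dots> \<le> exp (1 / (1 - r))"
      using assms by (intro summable_abs_eta_coeff(2)) auto
    finally show ?thesis using assms by (simp add: mult_left_mono divide_right_mono)
  qed
  ultimately show ?thesis
    by (intro Lim_bounded[where M = 0 and f = "\<lambda>D. norm (\<Sum>n<D. ?c (Suc n) * q ^ Suc n)"] tendsto_norm)
       (auto simp: sums_def)
qed

lemma holomorphic_euler_fun: "euler_fun holomorphic_on ball 0 1"
proof (rule power_series_holomorphic[where a = "\<lambda>n. of_int (eta_coeff n)"])
  fix w :: complex assume "w \<in> ball 0 1"
  thus "(\<lambda>n. of_int (eta_coeff n) * (w - 0) ^ n) sums euler_fun w"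
    using euler_fun_sums[of w] by simp
qed

section \<open>Partial fractions of coth and the Lambert series\<close>

text \<open>Euler's sine product at the imaginary point iw: both sides are purely imaginary there,
  and their imaginary parts give the real identity.\<close>

lemma sinh_product:
  fixes w :: real
  shows "(\<lambda>n. pi * w * (\<Prod>k=1..n. 1 + w\<^sup>2 / real k ^ 2)) \<longlonglongrightarrow> sinh (pi * w)"
proof -
  have "(\<lambda>n. Im (of_real pi * (\<i> * of_real w) * (\<Prod>k=1..n. 1 - (\<i> * of_real w)^2 / of_nat k^2)))
          \<longlonglongrightarrow> Im (sin (of_real pi * (\<i> * of_real w)))"
    by (intro tendsto_Im sin_product_formula_complex)
  moreover have "Im (of_real pi * (\<i> * of_real w) * (\<Prod>k=1..n. 1 - (\<i> * of_real w)^2 / of_nat k^2))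
      = pi * w * (\<Prod>k=1..n. 1 + w\<^sup>2 / real k ^ 2)" for n
  proof -
    have "(\<Prod>k=1..n. 1 - (\<i> * of_real w)^2 / of_nat k^2 :: complex)
        = of_real (\<Prod>k=1..n. 1 + w\<^sup>2 / real k ^ 2)"
      by (simp add: power_mult_distrib)
    thus ?thesis by (simp del: of_real_prod)
  qed
  moreover have "Im (sin (of_real pi * (\<i> * of_real w))) = sinh (pi * w)"
    by (simp add: Im_sin sinh_field_def)
  ultimately show ?thesis by (simp only:)
qed

lemma ln_sinh_sums:
  fixes w :: real
  assumes "w > 0"
  shows "(\<lambda>k. ln (1 + w\<^sup>2 / real (Suc k) ^ 2)) sums (ln (sinh (pi * w)) - ln (pi * w))"
proof -
  have pos: "1 + w\<^sup>2 / real k ^ 2 > 0" for k by (simp add: add_pos_nonneg)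
  have s: "sinh (pi * w) > 0" using assms by simp
  have "(\<lambda>n. ln (pi * w * (\<Prod>k=1..n. 1 + w\<^sup>2 / real k ^ 2)) - ln (pi * w))
          \<longlonglongrightarrow> ln (sinh (pi * w)) - ln (pi * w)"
    using s by (intro tendsto_intros sinh_product) auto
  moreover have "ln (pi * w * (\<Prod>k=1..n. 1 + w\<^sup>2 / real k ^ 2)) - ln (pi * w)
       = (\<Sum>k<n. ln (1 + w\<^sup>2 / real (Suc k) ^ 2))" for n
  proof -
    have "(\<Prod>k=1..n. 1 + w\<^sup>2 / real k ^ 2) > 0" by (intro prod_pos pos ballI)
    hence "ln ((pi * w) * (\<Prod>k=1..n. 1 + w\<^sup>2 / real k ^ 2))
        = ln (pi * w) + ln (\<Prod>k=1..n. 1 + w\<^sup>2 / real k ^ 2)"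
      using assms by (intro ln_mult_pos) auto
    hence "ln (pi * w * (\<Prod>k=1..n. 1 + w\<^sup>2 / real k ^ 2)) - ln (pi * w)
        = ln (\<Prod>k=1..n. 1 + w\<^sup>2 / real k ^ 2)"
      by simp
    also have "\<dots> = (\<Sum>k=1..n. ln (1 + w\<^sup>2 / real k ^ 2))"
      using less_imp_neq[OF pos, symmetric] by (intro ln_prod finite_atLeastAtMost)
    also have "\<dots> = (\<Sum>k<n. ln (1 + w\<^sup>2 / real (Suc k) ^ 2))"
      by (intro sum.reindex_bij_witness[of _ Suc "\<lambda>k. k - 1"]) auto
    finally show ?thesis .
  qed
  ultimately show ?thesis by (simp add: sums_def)
qed

text \<open>The logarithmic derivative of the product for sinh, obtained by differentiating
  \<open>ln_sinh_sums\<close> term by term.\<close>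

lemma coth_partial_fractions:
  fixes w :: real
  assumes "w > 0"
  shows "(\<lambda>k. 2 * w / (w\<^sup>2 + real (Suc k) ^ 2)) sums (pi * cosh (pi * w) / sinh (pi * w) - 1 / w)"
proof -
  \<comment> \<open>A neighbourhood of w inside the positive axis on which 2x < 4w, so that 4w / k^2
    is a summable majorant for all the differentiated terms.\<close>
  define S where "S = {0<..<2 * w}"
  have wS: "w \<in> interior S" "w \<in> S" using assms by (auto simp: S_def interior_open)
  let ?f = "\<lambda>k x. ln (1 + x\<^sup>2 / real (Suc k) ^ 2)"
  let ?f' = "\<lambda>k x. 2 * x / (x\<^sup>2 + real (Suc k) ^ 2)"
  have sq: "summable (\<lambda>k. 4 * w * (1 / real (Suc k) ^ 2))"
    using inverse_squares_sums by (intro summable_mult) (simp add: sums_iff add_ac)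
  have le: "?f' k x \<le> 4 * w * (1 / real (Suc k) ^ 2)" if "x \<in> S" for k x
  proof -
    have "?f' k x \<le> 4 * w / real (Suc k) ^ 2"
      using that by (intro frac_le) (auto simp: S_def)
    thus ?thesis by simp
  qed
  have deriv: "(?f k has_field_derivative ?f' k x) (at x within S)" if "x \<in> S" for k x
  proof -
    have "((\<lambda>x. ln (1 + x\<^sup>2 / c)) has_field_derivative (2 * x / c) / (1 + x\<^sup>2 / c)) (at x within S)"
      if "c > 0" for c :: real
    proof -
      have "1 + x\<^sup>2 / c > 0" using that by (simp add: add_pos_nonneg)
      thus ?thesis using that by (auto intro!: derivative_eq_intros)
    qed
    from this[of "real (Suc k) ^ 2"]
    have "(?f k has_field_derivative (2 * x / real (Suc k) ^ 2) / (1 + x\<^sup>2 / real (Suc k) ^ 2)) (at x within S)"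
      by simp
    moreover have "(2 * x / real (Suc k) ^ 2) / (1 + x\<^sup>2 / real (Suc k) ^ 2) = ?f' k x"
    proof -
      have "c > 0 \<Longrightarrow> (2 * x / c) / (1 + x\<^sup>2 / c) = 2 * x / (x\<^sup>2 + c)" for c
        using zero_le_power2[of x] by (simp add: divide_simps)
      thus ?thesis by simp
    qed
    ultimately show ?thesis by (simp only:)
  qed
  have "((\<lambda>x. \<Sum>k. ?f k x) has_field_derivative (\<Sum>k. ?f' k w)) (at w)"
  proof (rule has_field_derivative_series'(2)[where S = S and x0 = w])
    show "uniformly_convergent_on S (\<lambda>n x. \<Sum>i<n. ?f' i x)"
    proof (rule Weierstrass_m_test'[OF _ sq])
      fix k x assume "x \<in> S"
      thus "norm (?f' k x) \<le> 4 * w * (1 / real (Suc k) ^ 2)"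
        using le[of x k] by (simp add: S_def)
    qed
  qed (use wS deriv ln_sinh_sums[OF assms] in \<open>auto simp: S_def sums_iff\<close>)
  moreover have "eventually (\<lambda>x. x \<in> S) (nhds w)"
    using wS(2) by (intro eventually_nhds_in_open) (auto simp: S_def)
  hence "eventually (\<lambda>x. (\<Sum>k. ?f k x) = ln (sinh (pi * x)) - ln (pi * x)) (nhds w)"
    by eventually_elim (use ln_sinh_sums in \<open>auto simp: S_def sums_iff\<close>)
  ultimately have "((\<lambda>x. ln (sinh (pi * x)) - ln (pi * x)) has_field_derivative (\<Sum>k. ?f' k w)) (at w)"
    by (subst (asm) DERIV_cong_ev[OF refl _ refl])
  moreover have "((\<lambda>x. ln (sinh (pi * x)) - ln (pi * x)) has_field_derivative 
       (pi * cosh (pi * w) / sinh (pi * w) - 1 / w)) (at w)"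
    using assms by (auto intro!: derivative_eq_intros simp: field_simps)
  ultimately have "(\<Sum>k. ?f' k w) = pi * cosh (pi * w) / sinh (pi * w) - 1 / w"
    by (rule DERIV_unique)
  moreover have "summable (\<lambda>k. ?f' k w)"
    by (rule summable_comparison_test'[OF sq, of 0]) (use le[OF wS(2)] assms in auto)
  ultimately show ?thesis by (simp add: sums_iff)
qed

section \<open>The Lambert series as minus the logarithm of the Euler product\<close>

definition lambert :: "real \<Rightarrow> real" where
  "lambert y = (\<Sum>m. 1 / real (Suc m) / (exp (2 * pi * real (Suc m) * y) - 1))"

lemma lambert_summable:
  assumes "y > 0"
  shows "summable (\<lambda>m. 1 / real (Suc m) / (exp (2 * pi * real (Suc m) * y) - 1))"
proof -
  define r where "r = exp (- 2 * pi * y)"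
  have r: "0 < r" "r < 1" using assms by (auto simp: r_def)
  have "summable (\<lambda>m. 1 / (1 - r) * r ^ Suc m)"
    using r by (intro summable_mult) (simp add: summable_Suc_iff summable_geometric)
  thus ?thesis
  proof (rule summable_comparison_test'[where N = 0])
    fix m :: nat
    have e: "exp (2 * pi * real (Suc m) * y) = 1 / r ^ Suc m"
      by (simp add: r_def exp_minus field_simps flip: exp_of_nat_mult exp_add)
    have le: "r ^ Suc m \<le> r" using r power_decreasing[of 1 "Suc m" r] by simp
    hence "r ^ Suc m < 1" using r by linarith
    hence le1: "r * r ^ m < 1" by simp
    have "1 / (1 / r ^ Suc m - 1) = r ^ Suc m / (1 - r ^ Suc m)"
      using r le by (simp add: divide_simps)
    also have "\<dots> \<le> r ^ Suc m / (1 - r)"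
      using r le by (intro divide_left_mono mult_pos_pos) (simp_all only: diff_gt_0_iff_gt, auto)
    finally have "1 / (1 / r ^ Suc m - 1) \<le> 1 / (1 - r) * r ^ Suc m" by simp
    moreover have "1 / real (Suc m) * (1 / (1 / r ^ Suc m - 1)) \<le> 1 * (1 / (1 / r ^ Suc m - 1))"
      using r le1 by (intro mult_right_mono) (auto simp: divide_simps)
    moreover have "0 \<le> 1 / real (Suc m) * (1 / (1 / r ^ Suc m - 1))"
      using r le1 by (auto simp: divide_simps)
    ultimately show "norm (1 / real (Suc m) / (exp (2 * pi * real (Suc m) * y) - 1)) \<le> 1 / (1 - r) * r ^ Suc m"
      unfolding e by simp
  qed
qed

text \<open>The double series of r^(nm) / m is nonnegative and may be summed in either order.
  Summing over n first is a geometric series and gives the Lambert terms; summing over m first is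
  the series of -ln(1 - r^n).\<close>

lemma lambert_eq_ln_product:
  assumes "y > 0"
  shows "(\<lambda>n. - ln (1 - exp (- 2 * pi * y) ^ Suc n)) sums lambert y"
proof -
  define r where "r = exp (- 2 * pi * y)"
  have r: "0 < r" "r < 1" using assms by (auto simp: r_def)
  define f where "f = (\<lambda>(m, n). r ^ (Suc n * Suc m) / real (Suc m))"
  have f0: "f p \<ge> 0" for p using r by (auto simp: f_def split: prod.splits)
  have rp: "r ^ Suc m < 1" for m using r power_Suc_less_one by blast
  have 1: "((\<lambda>n. f (m, n)) has_sum (1 / real (Suc m) / (exp (2 * pi * real (Suc m) * y) - 1))) UNIV" for m
  proof -
    have e: "exp (2 * pi * real (Suc m) * y) = 1 / r ^ Suc m"
      by (simp add: r_def exp_minus field_simps flip: exp_of_nat_mult exp_add)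
    have "(\<lambda>n. r ^ Suc m * (r ^ Suc m) ^ n / real (Suc m)) sums (r ^ Suc m * (1 / (1 - r ^ Suc m)) / real (Suc m))"
      using r rp[of m] by (intro sums_divide sums_mult geometric_sums) auto
    moreover have "r ^ Suc m * (1 / (1 - r ^ Suc m)) / real (Suc m) = 1 / real (Suc m) / (exp (2 * pi * real (Suc m) * y) - 1)"
      unfolding e using r rp[of m] by (simp add: divide_simps)
    moreover have "r ^ Suc m * (r ^ Suc m) ^ n / real (Suc m) = f (m, n)" for n
      by (simp only: f_def prod.case mult.commute[of "Suc n"]) (simp only: power_mult power_Suc)
    ultimately have "(\<lambda>n. f (m, n)) sums (1 / real (Suc m) / (exp (2 * pi * real (Suc m) * y) - 1))" by simp
    thus ?thesis by (intro sums_nonneg_imp_has_sum f0)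
  qed
  have 2: "((\<lambda>m. 1 / real (Suc m) / (exp (2 * pi * real (Suc m) * y) - 1)) has_sum lambert y) UNIV"
    unfolding lambert_def using lambert_summable[OF assms] assms
    by (intro sums_nonneg_imp_has_sum summable_sums) auto
  have sf: "f summable_on UNIV \<times> UNIV"
    by (rule summable_on_SigmaI[OF 1 has_sum_imp_summable[OF 2]]) (rule f0)
  have 3: "(f has_sum lambert y) (UNIV \<times> UNIV)"
    by (rule has_sum_SigmaI[OF 1 2 sf])
  have 4: "((\<lambda>(n, m). f (m, n)) has_sum lambert y) (UNIV \<times> UNIV)"
    using 3 has_sum_swap[of f UNIV UNIV "lambert y"] by (simp add: case_prod_unfold)
  have 5: "((\<lambda>m. (\<lambda>(n, m). f (m, n)) (n, m)) has_sum (- ln (1 - r ^ Suc n))) UNIV" for n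
  proof -
    have "\<bar>- (r ^ Suc n)\<bar> < 1" using r rp[of n] by simp
    from sums_minus[OF ln_series'[OF this]]
    have "(\<lambda>m. (r ^ Suc n) ^ m / real m) sums (- ln (1 - r ^ Suc n))"
      by (simp only: minus_minus divide_minus_left add_uminus_conv_diff)
    \<comment> \<open>The term at m = 0 is 1 / 0, which equals 0, so shifting the index leaves the
      sum unchanged.\<close>
    hence "(\<lambda>m. (r ^ Suc n) ^ Suc m / real (Suc m)) sums (- ln (1 - r ^ Suc n))"
      by (subst sums_Suc_iff) simp
    moreover have "(r ^ Suc n) ^ Suc m / real (Suc m) = f (m, n)" for m
      by (simp only: f_def prod.case power_mult)
    ultimately have "(\<lambda>m. f (m, n)) sums (- ln (1 - r ^ Suc n))" by simp
    thus ?thesis by (simp, intro sums_nonneg_imp_has_sum f0)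
  qed
  have "((\<lambda>n. - ln (1 - r ^ Suc n)) has_sum lambert y) UNIV"
    by (rule has_sum_SigmaD[OF 4 5])
  thus ?thesis unfolding r_def by (rule has_sum_imp_sums)
qed

section \<open>Reciprocity of the Lambert series\<close>

text \<open>For \<open>y = a/b\<close> this is \<open>y / (m\<^sup>2 y\<^sup>2 + k\<^sup>2)\<close>, with both indices shifted to start at 0.\<close>
definition cell :: "nat \<Rightarrow> nat \<Rightarrow> nat \<Rightarrow> nat \<Rightarrow> real" where
  "cell a b m k = real a * real b / ((real a * real (Suc m))\<^sup>2 + (real b * real (Suc k))\<^sup>2)"

lemma cell_commute: "cell a b m k = cell b a k m"
  by (simp add: cell_def add.commute mult.commute)

lemma summable_inverse_squares: "summable (\<lambda>k. 1 / real (Suc k) ^ 2)"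
  using inverse_squares_sums by (simp add: sums_iff add_ac)

lemma summable_cell:
  assumes "b > 0"
  shows "summable (\<lambda>k. cell a b m k)"
proof (rule summable_comparison_test'[where N = 0])
  show "summable (\<lambda>k. real a / real b * (1 / real (Suc k) ^ 2))"
    by (intro summable_mult summable_inverse_squares)
  fix k
  have "cell a b m k \<le> real a * real b / (real b * real (Suc k))\<^sup>2"
    unfolding cell_def using assms by (intro divide_left_mono mult_pos_pos add_nonneg_pos) auto
  also have "\<dots> = real a / real b * (1 / real (Suc k) ^ 2)"
    using assms by (simp add: power2_eq_square)
  finally show "norm (cell a b m k) \<le> real a / real b * (1 / real (Suc k) ^ 2)"
    by (simp add: cell_def)
qed

text \<open>With w = (m + 1) y one has 1 / (exp(2 pi w) - 1) = (coth(pi w) - 1) / 2. The partial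
  fractions of coth give the row of cells, the -1 gives the harmonic term, and the pole 1/w gives
  the inverse square.\<close>

lemma lambert_term_eq:
  assumes "a > 0" "b > 0"
  defines "y \<equiv> real a / real b"
  shows "1 / real (Suc m) / (exp (2 * pi * real (Suc m) * y) - 1) =
           (\<Sum>k. cell a b m k) / pi - inverse (real (Suc m)) / 2 + 1 / (2 * pi * y) * (1 / real (Suc m) ^ 2)"
proof -
  define M where "M = real (Suc m)"
  define w where "w = M * y"
  have pos: "M > 0" "y > 0" "w > 0" using assms by (auto simp: M_def w_def)
  define E where "E = exp (2 * pi * w)"
  have E: "E > 1" using pos by (simp add: E_def)
  have C: "cosh (pi * w) / sinh (pi * w) = 1 + 2 / (E - 1)"
  proof -
    have e: "exp (pi * w) * exp (pi * w) = E"
      by (simp add: E_def flip: exp_add)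
    have "cosh (pi * w) / sinh (pi * w) = (2 * exp (pi * w) * cosh (pi * w)) / (2 * exp (pi * w) * sinh (pi * w))"
      by simp
    also have "2 * exp (pi * w) * cosh (pi * w) = E + 1"
      by (simp add: cosh_field_def distrib_left exp_minus flip: e)
    also have "2 * exp (pi * w) * sinh (pi * w) = E - 1"
      by (simp add: sinh_field_def right_diff_distrib exp_minus flip: e)
    also have "(E + 1) / (E - 1) = 1 + 2 / (E - 1)" using E by (simp add: field_simps)
    finally show ?thesis .
  qed
  have "(\<lambda>k. 1 / (2 * M) * (2 * w / (w\<^sup>2 + real (Suc k) ^ 2))) sums
          (1 / (2 * M) * (pi * cosh (pi * w) / sinh (pi * w) - 1 / w))"
    by (intro sums_mult coth_partial_fractions pos)
  moreover have "1 / (2 * M) * (2 * w / (w\<^sup>2 + real (Suc k) ^ 2)) = cell a b m k" for k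
  proof -
    define K where "K = real (Suc k)"
    have "K > 0" by (simp add: K_def)
    hence nz: "M\<^sup>2 * (real a)\<^sup>2 + K\<^sup>2 * (real b)\<^sup>2 > 0"
      using pos assms by (intro add_pos_pos mult_pos_pos) auto
    have "w\<^sup>2 + K\<^sup>2 = (M\<^sup>2 * (real a)\<^sup>2 + K\<^sup>2 * (real b)\<^sup>2) / (real b)\<^sup>2"
      using assms by (simp add: w_def y_def power_mult_distrib power_divide add_divide_distrib)
    hence "1 / (2 * M) * (2 * w / (w\<^sup>2 + K\<^sup>2)) =
            y / ((M\<^sup>2 * (real a)\<^sup>2 + K\<^sup>2 * (real b)\<^sup>2) / (real b)\<^sup>2)"
      using pos by (simp add: w_def)
    also have "\<dots> = real a * real b / (M\<^sup>2 * (real a)\<^sup>2 + K\<^sup>2 * (real b)\<^sup>2)"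
      using assms nz by (simp add: y_def power2_eq_square)
    finally show ?thesis by (simp add: cell_def power_mult_distrib K_def M_def mult.commute)
  qed
  ultimately have cell_eq: "(\<Sum>k. cell a b m k) = 1 / (2 * M) * (pi * (1 + 2 / (E - 1)) - 1 / w)"
    using C by (simp add: sums_iff flip: times_divide_eq_right)
  have "(\<Sum>k. cell a b m k) / pi = 1 / M / (E - 1) + inverse M / 2 - 1 / (2 * pi * y) * (1 / M ^ 2)"
  proof -
    have "1 / (2 * M) * (pi * (1 + 2 * X) - 1 / (M * y)) / pi = X / M + inverse M / 2 - 1 / (2 * pi * y) * (1 / M ^ 2)" for X
      using pos by (simp add: field_simps power2_eq_square)
    from this[of "1 / (E - 1)"] show ?thesis unfolding cell_eq w_def by simp
  qed
  thus ?thesis by (simp add: E_def M_def w_def mult.assoc)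
qed

text \<open>Summing \<open>lambert_term_eq\<close> over m: the inverse squares contribute pi^2 / 6,
  hence pi / (12 y). The sum of the row sums and the harmonic series both diverge, and only their
  combination has a limit.\<close>

lemma lambert_limit:
  assumes "a > 0" "b > 0"
  defines "y \<equiv> real a / real b"
  shows "(\<lambda>M. (\<Sum>m<M. \<Sum>k. cell a b m k) / pi - harm M / 2) \<longlonglongrightarrow> lambert y - pi / (12 * y)"
proof -
  have y: "y > 0" using assms by simp
  have "(\<lambda>M. (\<Sum>m<M. 1 / real (Suc m) / (exp (2 * pi * real (Suc m) * y) - 1))
          - 1 / (2 * pi * y) * (\<Sum>m<M. 1 / real (Suc m) ^ 2)) \<longlonglongrightarrow>
        lambert y - 1 / (2 * pi * y) * (pi\<^sup>2 / 6)"
    using lambert_summable[OF y] inverse_squares_sums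
    by (intro tendsto_intros) (auto simp: lambert_def sums_def add_ac dest!: summable_LIMSEQ)
  moreover have "1 / (2 * pi * y) * (pi\<^sup>2 / 6) = pi / (12 * y)"
    using y by (simp add: power2_eq_square)
  moreover have "(\<Sum>m<M. 1 / real (Suc m) / (exp (2 * pi * real (Suc m) * y) - 1))
          - 1 / (2 * pi * y) * (\<Sum>m<M. 1 / real (Suc m) ^ 2)
        = (\<Sum>m<M. \<Sum>k. cell a b m k) / pi - harm M / 2" for M
    unfolding y_def lambert_term_eq[OF assms(1,2)] harm_altdef
    by (simp only: sum.distrib sum_subtractf sum_distrib_left sum_divide_distrib of_nat_id)
  ultimately show ?thesis by (simp only:)
qed

text \<open>Over a common denominator the numerator is a sum of two differences of squares, at most
  2V(a + b) because no coordinate exceeds V, while the denominator is at least V^2 (V/2)^2.\<close>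

lemma inverse_square_norm_diff_le:
  fixes U V U' V' :: real
  assumes "0 \<le> U'" "U' \<le> U" "U - U' \<le> a" "U \<le> V" "V / 2 \<le> V'" "V' \<le> V" "V - V' \<le> b" "V > 0"
  shows "\<bar>1 / (U\<^sup>2 + V\<^sup>2) - 1 / (U'\<^sup>2 + V'\<^sup>2)\<bar> \<le> 8 * (a + b) / V ^ 3"
proof -
  have p: "U\<^sup>2 + V\<^sup>2 > 0" "U'\<^sup>2 + V'\<^sup>2 > 0"
    using assms by (auto intro!: add_nonneg_pos)
  have le: "U'\<^sup>2 + V'\<^sup>2 \<le> U\<^sup>2 + V\<^sup>2"
    using assms by (intro add_mono power_mono) auto
  have "\<bar>1 / (U\<^sup>2 + V\<^sup>2) - 1 / (U'\<^sup>2 + V'\<^sup>2)\<bar> = 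
         ((U\<^sup>2 - U'\<^sup>2) + (V\<^sup>2 - V'\<^sup>2)) / ((U\<^sup>2 + V\<^sup>2) * (U'\<^sup>2 + V'\<^sup>2))"
  proof -
    have "1 / (U\<^sup>2 + V\<^sup>2) \<le> 1 / (U'\<^sup>2 + V'\<^sup>2)" using p le by (intro divide_left_mono) auto
    hence "\<bar>1 / (U\<^sup>2 + V\<^sup>2) - 1 / (U'\<^sup>2 + V'\<^sup>2)\<bar> = 1 / (U'\<^sup>2 + V'\<^sup>2) - 1 / (U\<^sup>2 + V\<^sup>2)" by simp
    also have "\<dots> = ((U\<^sup>2 + V\<^sup>2) - (U'\<^sup>2 + V'\<^sup>2)) / ((U\<^sup>2 + V\<^sup>2) * (U'\<^sup>2 + V'\<^sup>2))"
      using p by (subst diff_frac_eq) (simp_all only: less_imp_neq[symmetric] mult_ac not_False_eq_True mult_1)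
    finally show ?thesis by (simp add: algebra_simps)
  qed
  also have "\<dots> \<le> (2 * V * (a + b)) / (V\<^sup>2 * (V / 2)\<^sup>2)"
  proof (intro frac_le mult_mono)
    have "U\<^sup>2 - U'\<^sup>2 = (U - U') * (U + U')" by (simp add: power2_eq_square algebra_simps)
    also have "\<dots> \<le> a * (2 * V)" using assms by (intro mult_mono) auto
    finally have 1: "U\<^sup>2 - U'\<^sup>2 \<le> a * (2 * V)" .
    have "V\<^sup>2 - V'\<^sup>2 = (V - V') * (V + V')" by (simp add: power2_eq_square algebra_simps)
    also have "\<dots> \<le> b * (2 * V)" using assms by (intro mult_mono) auto
    finally show "U\<^sup>2 - U'\<^sup>2 + (V\<^sup>2 - V'\<^sup>2) \<le> 2 * V * (a + b)" using 1 by (simp add: algebra_simps)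
    have "(V / 2)\<^sup>2 \<le> V'\<^sup>2" using assms by (intro power_mono) auto
    thus "(V / 2)\<^sup>2 \<le> U'\<^sup>2 + V'\<^sup>2" by (simp add: add_increasing)
  qed (use assms in auto)
  also have "\<dots> = 8 * (a + b) / V ^ 3"
    using assms by (simp add: power2_eq_square power3_eq_cube)
  finally show ?thesis .
qed

text \<open>
  Refining every cell to the unit lattice turns the strips \<open>m \<le> bN, k > aN\<close> and \<open>m > bN, k \<le> aN\<close>
  into mirror images of each other, so that in the limit they cancel and only the difference of
  the harmonic numbers contributes to the reciprocity law.
\<close>
lemma cell_block_diff_le:
  assumes "a > 0" "b > 0" "m < b * N" "k \<ge> a * N" "N > 0"
  shows "\<bar>cell a b m k - (\<Sum>u\<in>{m*a..<m*a+a}. \<Sum>v\<in>{k*b..<k*b+b}. cell 1 1 u v)\<bar>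
           \<le> 8 * a * b * (a + b) / real (Suc k) ^ 3"
proof -
  define U where "U = real a * real (Suc m)"
  define V where "V = real b * real (Suc k)"
  define c where "c = 1 / (U\<^sup>2 + V\<^sup>2)"
  have Vk: "V \<ge> real (Suc k)" using assms by (simp add: V_def)
  have "a * N > 0" using assms by simp
  hence k1: "k \<ge> 1" using assms(4) by linarith
  have UV: "U \<le> V"
  proof -
    have "a * Suc m \<le> a * (b * N)" using assms by (intro mult_left_mono) auto
    also have "\<dots> = b * (a * N)" by simp
    also have "\<dots> \<le> b * Suc k" using assms by (intro mult_left_mono) auto
    finally show ?thesis unfolding U_def V_def of_nat_mult[symmetric] of_nat_le_iff .
  qed
  \<comment> \<open>A coarse cell is a * b equal copies of \<open>c\<close>, one for each unit cell
    of its block, so the comparison can be made cell by cell.\<close>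
  have "cell a b m k = (\<Sum>u\<in>{m*a..<m*a+a}. \<Sum>v\<in>{k*b..<k*b+b}. c)"
    by (simp add: cell_def c_def U_def V_def)
  hence "\<bar>cell a b m k - (\<Sum>u\<in>{m*a..<m*a+a}. \<Sum>v\<in>{k*b..<k*b+b}. cell 1 1 u v)\<bar>
      = \<bar>\<Sum>u\<in>{m*a..<m*a+a}. \<Sum>v\<in>{k*b..<k*b+b}. c - cell 1 1 u v\<bar>"
    by (simp only: sum_subtractf)
  also have "\<dots> \<le> (\<Sum>u\<in>{m*a..<m*a+a}. \<Sum>v\<in>{k*b..<k*b+b}. \<bar>c - cell 1 1 u v\<bar>)"
    by (rule order.trans[OF sum_abs sum_mono[OF sum_abs]])
  also have "\<dots> \<le> (\<Sum>u\<in>{m*a..<m*a+a}. \<Sum>v\<in>{k*b..<k*b+b}. 8 * (a + b) / real (Suc k) ^ 3)"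
  proof (intro sum_mono)
    fix u v assume u: "u \<in> {m*a..<m*a+a}" and v: "v \<in> {k*b..<k*b+b}"
    have u1: "Suc u \<le> a * Suc m" "a * Suc m \<le> Suc u + a" using u by (auto simp: mult.commute)
    have v1: "Suc v \<le> b * Suc k" "b * Suc k \<le> Suc v + b" using v by (auto simp: mult.commute)
    \<comment> \<open>Since k is at least 1, the block starts no closer to the origin than its own
      width b, hence V is at most twice v + 1.\<close>
    have "b * 1 \<le> b * k" using k1 by (intro mult_left_mono) linarith+
    hence "b \<le> b * k" by (simp only: mult_1_right)
    moreover have "b * k \<le> v" using v by (simp add: mult.commute)
    ultimately have v2: "b * Suc k \<le> 2 * Suc v" unfolding mult_Suc_right by linarith
    have r: "real (Suc u) \<le> U" "U - real (Suc u) \<le> a" "real (Suc v) \<le> V" "V - real (Suc v) \<le> b"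
      using u1 v1 unfolding U_def V_def of_nat_mult[symmetric] by linarith+
    have "V \<le> 2 * real (Suc v)"
      using of_nat_mono[OF v2, where 'a = real] unfolding V_def by (simp only: of_nat_mult of_nat_numeral)
    hence "V / 2 \<le> real (Suc v)" by simp
    note r = r this
    have "\<bar>1 / (U\<^sup>2 + V\<^sup>2) - 1 / (real (Suc u) ^ 2 + real (Suc v) ^ 2)\<bar> \<le> 8 * (real a + real b) / V ^ 3"
      using r UV Vk by (intro inverse_square_norm_diff_le) auto
    also have "\<dots> \<le> 8 * (real a + real b) / real (Suc k) ^ 3"
      using Vk by (intro divide_left_mono power_mono mult_pos_pos zero_less_power) auto
    finally show "\<bar>c - cell 1 1 u v\<bar> \<le> 8 * (a + b) / real (Suc k) ^ 3"
      by (simp add: c_def cell_def)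
  qed
  also have "\<dots> = 8 * real a * real b * (real a + real b) / real (Suc k) ^ 3" by simp
  finally show ?thesis .
qed

section \<open>Comparing the strips with the unit lattice, and the reciprocity law\<close>

lemma suminf_tail_tendsto_0:
  fixes f :: "nat \<Rightarrow> real"
  assumes "summable f"
  shows "(\<lambda>n. \<Sum>k. f (k + n)) \<longlonglongrightarrow> 0"
proof -
  have "(\<lambda>n. suminf f - (\<Sum>i<n. f i)) \<longlonglongrightarrow> suminf f - suminf f"
    by (intro tendsto_intros summable_LIMSEQ assms)
  thus ?thesis using suminf_minus_initial_segment[OF assms] by simp
qed

text \<open>Blocks of size a by b tile the strip u < abN, v >= abN of the unit lattice, one block
  for each coarse cell with m < bN and k >= aN. Summability of the block sums allows subtracting
  them termwise from the cells.\<close>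

lemma strip_sum_eq_blocks:
  assumes "a > 0" "b > 0"
  shows "(\<Sum>u<a*b*N. \<Sum>v. cell 1 1 u (v + a*b*N)) =
     (\<Sum>m<b*N. \<Sum>k. \<Sum>u\<in>{m*a..<m*a+a}. \<Sum>v\<in>{(k+a*N)*b..<(k+a*N)*b+b}. cell 1 1 u v)"
    and "summable (\<lambda>k. \<Sum>u\<in>{m*a..<m*a+a}. \<Sum>v\<in>{(k+a*N)*b..<(k+a*N)*b+b}. cell 1 1 u v)"
proof -
  have grp: "(\<lambda>k. \<Sum>v\<in>{(k+a*N)*b..<(k+a*N)*b+b}. cell 1 1 u v) sums (\<Sum>v. cell 1 1 u (v + a*b*N))" for u
  proof -
    have "(\<lambda>v. cell 1 1 u (v + a*b*N)) sums (\<Sum>v. cell 1 1 u (v + a*b*N))"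
      by (intro summable_sums summable_ignore_initial_segment summable_cell) auto
    from sums_group[OF this assms(2)]
    have "(\<lambda>k. \<Sum>v\<in>{k*b..<k*b+b}. cell 1 1 u (v + a*b*N)) sums (\<Sum>v. cell 1 1 u (v + a*b*N))" .
    moreover have "(\<Sum>v\<in>{k*b..<k*b+b}. cell 1 1 u (v + a*b*N)) = (\<Sum>v\<in>{(k+a*N)*b..<(k+a*N)*b+b}. cell 1 1 u v)" for k
      by (rule sum.reindex_bij_witness[of _ "\<lambda>v. v - a*b*N" "\<lambda>v. v + a*b*N"]) (auto simp: algebra_simps)
    ultimately show ?thesis by simp
  qed
  show "summable (\<lambda>k. \<Sum>u\<in>{m*a..<m*a+a}. \<Sum>v\<in>{(k+a*N)*b..<(k+a*N)*b+b}. cell 1 1 u v)"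
    using grp by (intro summable_sum) (auto simp: sums_iff)
  have "(\<Sum>u<a*b*N. \<Sum>v. cell 1 1 u (v + a*b*N)) = (\<Sum>u<(b*N)*a. \<Sum>v. cell 1 1 u (v + a*b*N))"
    by (simp add: mult_ac)
  also have "\<dots> = (\<Sum>m<b*N. \<Sum>u\<in>{m*a..<m*a+a}. \<Sum>v. cell 1 1 u (v + a*b*N))"
    by (rule sum.nat_group[symmetric])
  also have "\<dots> = (\<Sum>m<b*N. \<Sum>k. \<Sum>u\<in>{m*a..<m*a+a}. \<Sum>v\<in>{(k+a*N)*b..<(k+a*N)*b+b}. cell 1 1 u v)"
  proof (intro sum.cong refl)
    fix m
    have "(\<lambda>k. \<Sum>u\<in>{m*a..<m*a+a}. \<Sum>v\<in>{(k+a*N)*b..<(k+a*N)*b+b}. cell 1 1 u v) sums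
            (\<Sum>u\<in>{m*a..<m*a+a}. \<Sum>v. cell 1 1 u (v + a*b*N))"
      by (intro sums_sum grp)
    thus "(\<Sum>u\<in>{m*a..<m*a+a}. \<Sum>v. cell 1 1 u (v + a*b*N)) =
      (\<Sum>k. \<Sum>u\<in>{m*a..<m*a+a}. \<Sum>v\<in>{(k+a*N)*b..<(k+a*N)*b+b}. cell 1 1 u v)"
      by (simp add: sums_iff)
  qed
  finally show "(\<Sum>u<a*b*N. \<Sum>v. cell 1 1 u (v + a*b*N)) =
     (\<Sum>m<b*N. \<Sum>k. \<Sum>u\<in>{m*a..<m*a+a}. \<Sum>v\<in>{(k+a*N)*b..<(k+a*N)*b+b}. cell 1 1 u v)" .
qed

text \<open>By \<open>cell_block_diff_le\<close> a cell differs from its block by O(k^-3). In the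
  strip one factor 1/k is at most 1/N, which compensates for the bN rows; what remains is a tail of
  the series of inverse squares.\<close>

lemma strip_sum_diff_tendsto_0:
  assumes "a > 0" "b > 0"
  shows "(\<lambda>N. (\<Sum>m<b*N. \<Sum>k. cell a b m (k + a*N)) - (\<Sum>u<a*b*N. \<Sum>v. cell 1 1 u (v + a*b*N)))
           \<longlonglongrightarrow> 0"
proof (rule Lim_null_comparison)
  define C where "C = 8 * real a * real b * (real a + real b)"
  define T where "T n = (\<Sum>k. 1 / real (Suc (k + n)) ^ 2)" for n
  have C: "C \<ge> 0" by (simp add: C_def)
  have "(\<lambda>N. C * b * T (a * N)) \<longlonglongrightarrow> C * b * 0"
    unfolding T_def using assms
    by (intro tendsto_mult tendsto_const
          filterlim_compose[OF suminf_tail_tendsto_0[OF summable_inverse_squares]] mult_nat_left_at_top)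
  thus "(\<lambda>N. C * b * T (a * N)) \<longlonglongrightarrow> 0" by simp
  have "\<bar>(\<Sum>m<b*N. \<Sum>k. cell a b m (k + a*N)) - (\<Sum>u<a*b*N. \<Sum>v. cell 1 1 u (v + a*b*N))\<bar>
          \<le> C * b * T (a * N)" if "N > 0" for N
  proof -
    let ?B = "\<lambda>m k. \<Sum>u\<in>{m*a..<m*a+a}. \<Sum>v\<in>{(k+a*N)*b..<(k+a*N)*b+b}. cell 1 1 u v"
    have sumT: "summable (\<lambda>k. 1 / real (Suc (k + a * N)) ^ 2)"
      by (rule summable_ignore_initial_segment[OF summable_inverse_squares])
    have sc: "summable (\<lambda>k. cell a b m (k + a * N))" for m
      by (rule summable_ignore_initial_segment[OF summable_cell[OF assms(2)]])
    have d: "\<bar>(\<Sum>k. cell a b m (k + a*N)) - (\<Sum>k. ?B m k)\<bar> \<le> C / N * T (a * N)" if m: "m < b * N" for m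
    proof -
      have le: "\<bar>cell a b m (k + a*N) - ?B m k\<bar> \<le> C / N * (1 / real (Suc (k + a * N)) ^ 2)" for k
      proof -
        have "\<bar>cell a b m (k + a*N) - ?B m k\<bar> \<le> C / real (Suc (k + a * N)) ^ 3"
          unfolding C_def using cell_block_diff_le[OF assms m _ \<open>N > 0\<close>, of "k + a * N"] by simp
        also have "\<dots> \<le> C / (N * real (Suc (k + a * N)) ^ 2)"
        proof (intro divide_left_mono C)
          have "1 * N \<le> a * N" using assms by (intro mult_right_mono) auto
          hence "N \<le> Suc (k + a * N)" by linarith
          hence "real N \<le> real (Suc (k + a * N))" by (rule of_nat_mono)
          hence "real N * real (Suc (k + a * N)) ^ 2 \<le> real (Suc (k + a * N)) * real (Suc (k + a * N)) ^ 2"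
            by (intro mult_right_mono) auto
          thus "real N * real (Suc (k + a * N)) ^ 2 \<le> real (Suc (k + a * N)) ^ 3"
            by (simp only: power3_eq_cube power2_eq_square mult.assoc)
          show "0 < real (Suc (k + a * N)) ^ 3 * (real N * real (Suc (k + a * N)) ^ 2)"
            using \<open>N > 0\<close> by (intro mult_pos_pos zero_less_power of_nat_0_less_iff[THEN iffD2] zero_less_Suc)
        qed
        finally show ?thesis by simp
      qed
      have s1: "summable (\<lambda>k. C / N * (1 / real (Suc (k + a * N)) ^ 2))"
        by (intro summable_mult sumT)
      have s2: "summable (\<lambda>k. \<bar>cell a b m (k + a*N) - ?B m k\<bar>)"
        by (rule summable_comparison_test'[OF s1, of 0]) (use le in auto)
      have "\<bar>(\<Sum>k. cell a b m (k + a*N)) - (\<Sum>k. ?B m k)\<bar> = \<bar>\<Sum>k. cell a b m (k + a*N) - ?B m k\<bar>"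
        by (intro arg_cong[where f = abs] suminf_diff sc strip_sum_eq_blocks(2) assms)
      also have "\<dots> \<le> (\<Sum>k. \<bar>cell a b m (k + a*N) - ?B m k\<bar>)"
        by (intro summable_rabs s2)
      also have "\<dots> \<le> (\<Sum>k. C / N * (1 / real (Suc (k + a * N)) ^ 2))"
      proof (rule suminf_le)
        show "summable (\<lambda>k. \<bar>cell a b m (k + a*N) - ?B m k\<bar>)" by (fact s2)
        show "summable (\<lambda>k. C / N * (1 / real (Suc (k + a * N)) ^ 2))" by (fact s1)
      qed (fact le)
      also have "\<dots> = C / N * T (a * N)"
        unfolding T_def by (rule suminf_mult[OF sumT])
      finally show ?thesis .
    qed
    have "\<bar>(\<Sum>m<b*N. \<Sum>k. cell a b m (k + a*N)) - (\<Sum>u<a*b*N. \<Sum>v. cell 1 1 u (v + a*b*N))\<bar>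
       = \<bar>\<Sum>m<b*N. (\<Sum>k. cell a b m (k + a*N)) - (\<Sum>k. ?B m k)\<bar>"
      by (simp only: strip_sum_eq_blocks(1)[OF assms] sum_subtractf)
    also have "\<dots> \<le> (\<Sum>m<b*N. C / N * T (a * N))"
      by (rule order.trans[OF sum_abs sum_mono[OF d]]) simp
    also have "\<dots> = C * b * T (a * N)" using that by simp
    finally show ?thesis .
  qed
  thus "\<forall>\<^sub>F N in sequentially. norm ((\<Sum>m<b*N. \<Sum>k. cell a b m (k + a*N)) - (\<Sum>u<a*b*N. \<Sum>v. cell 1 1 u (v + a*b*N)))
          \<le> C * b * T (a * N)"
    by (intro eventually_mono[OF eventually_gt_at_top[of 0]]) simp
qed

text \<open>The cutoffs bN and aN are chosen so that both truncations contain the same box m < bN, k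
  < aN, which cancels by \<open>cell_commute\<close>. The leftover strips cancel in the limit, and
  the harmonic numbers contribute the limit -ln y of harm(bN) - harm(aN).\<close>

lemma lambert_reciprocity_rational:
  assumes "a > 0" "b > 0"
  defines "y \<equiv> real a / real b"
  shows "lambert y - pi / (12 * y) - (lambert (1 / y) - pi * y / 12) = ln y / 2"
proof -
  define S where "S a b M = (\<Sum>m<M. \<Sum>k. cell a b m k)" for a b M
  define E where "E a b N = (\<Sum>m<b*N. \<Sum>k. cell a b m (k + a*N))" for a b N
  \<comment> \<open>Refined to the unit lattice, both strips lie outside the same square of side R =
    abN and are mirror images of each other, so a single \<open>Q\<close> approximates both.\<close>
  define Q where "Q R = (\<Sum>u<R. \<Sum>v. cell 1 1 u (v + R))" for R
  have lim1: "(\<lambda>N. S a b (b * N) / pi - harm (b * N) / 2) \<longlonglongrightarrow> lambert y - pi / (12 * y)"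
    using filterlim_compose[OF lambert_limit[OF assms(1,2)] mult_nat_left_at_top[OF assms(2)]]
    by (simp only: S_def y_def)
  have lim2: "(\<lambda>N. S b a (a * N) / pi - harm (a * N) / 2) \<longlonglongrightarrow> lambert (1 / y) - pi * y / 12"
    using filterlim_compose[OF lambert_limit[OF assms(2,1)] mult_nat_left_at_top[OF assms(1)]]
    by (simp add: S_def y_def mult.commute)
  have SE: "S a b (b * N) = (\<Sum>m<b*N. \<Sum>k<a*N. cell a b m k) + E a b N" if "b > 0" for a b N
    unfolding S_def E_def sum.distrib[symmetric]
    by (intro sum.cong refl) (simp only: suminf_split_initial_segment[OF summable_cell[OF that], of _ _ "a * N"] add.commute)
  have Srel: "S a b (b * N) - S b a (a * N) = E a b N - E b a N" for N
  proof -
    have "(\<Sum>m<b*N. \<Sum>k<a*N. cell a b m k) = (\<Sum>k<a*N. \<Sum>m<b*N. cell b a k m)"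
      by (subst sum.swap) (simp only: cell_commute[of a b])
    thus ?thesis using SE assms by simp
  qed
  have EQ: "(\<lambda>N. E a b N - Q (a * b * N)) \<longlonglongrightarrow> 0"
    using strip_sum_diff_tendsto_0[OF assms(1,2)] by (simp only: E_def Q_def)
  have EQ': "(\<lambda>N. E b a N - Q (a * b * N)) \<longlonglongrightarrow> 0"
    using strip_sum_diff_tendsto_0[OF assms(2,1)] by (simp only: E_def Q_def mult.commute[of b a])
  have harm: "(\<lambda>N. harm (b * N) - harm (a * N)) \<longlonglongrightarrow> - ln y"
  proof -
    let ?g = "\<lambda>n. harm n - ln (real n)"
    have "(\<lambda>N. ?g (b * N) - ?g (a * N) - ln y) \<longlonglongrightarrow> euler_mascheroni - euler_mascheroni - ln y"
      using assms by (intro tendsto_diff tendsto_const filterlim_compose[OF euler_mascheroni_LIMSEQ] mult_nat_left_at_top)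
    moreover have "?g (b * N) - ?g (a * N) - ln y = harm (b * N) - harm (a * N)" if "N > 0" for N
      using assms that by (simp add: ln_mult ln_div)
    hence "\<forall>\<^sub>F N in sequentially. ?g (b * N) - ?g (a * N) - ln y = harm (b * N) - harm (a * N)"
      by (intro eventually_mono[OF eventually_gt_at_top[of 0]]) simp
    ultimately show ?thesis by (simp only: filterlim_cong[OF refl refl]) simp
  qed
  have "(\<lambda>N. (S a b (b * N) / pi - harm (b * N) / 2) - (S b a (a * N) / pi - harm (a * N) / 2)) \<longlonglongrightarrow>
     (lambert y - pi / (12 * y)) - (lambert (1 / y) - pi * y / 12)"
    by (intro tendsto_diff lim1 lim2)
  moreover have "(\<lambda>N. ((E a b N - Q (a * b * N)) - (E b a N - Q (a * b * N))) / pi - (harm (b * N) - harm (a * N)) / 2)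
      \<longlonglongrightarrow> (0 - 0) / pi - (- ln y) / 2"
    by (intro tendsto_intros EQ EQ' harm) auto
  moreover have "((E a b N - Q (a * b * N)) - (E b a N - Q (a * b * N))) / pi - (harm (b * N) - harm (a * N)) / 2
      = (S a b (b * N) / pi - harm (b * N) / 2) - (S b a (a * N) / pi - harm (a * N) / 2)" for N
  proof -
    have "(E a b N - Q (a * b * N)) - (E b a N - Q (a * b * N)) = S a b (b * N) - S b a (a * N)"
      using Srel by simp
    thus ?thesis by (simp add: diff_divide_distrib)
  qed
  ultimately have "(lambert y - pi / (12 * y)) - (lambert (1 / y) - pi * y / 12) = (0 - 0) / pi - (- ln y) / 2"
    by (simp only: LIMSEQ_unique)
  thus ?thesis by simp
qed

section \<open>The Dedekind eta function\<close>

definition dedekind_eta :: "complex \<Rightarrow> complex" where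
  "dedekind_eta z = exp (pi * \<i> * z / 12) * euler_fun (exp (2 * pi * \<i> * z))"

lemma norm_nome: "norm (exp (2 * pi * \<i> * z)) = exp (- 2 * pi * Im z)"
  by (simp add: norm_exp_eq_Re)

lemma norm_dedekind_eta:
  "norm (dedekind_eta z) = exp (- pi * Im z / 12) * norm (euler_fun (exp (2 * pi * \<i> * z)))"
  by (simp add: dedekind_eta_def norm_mult norm_exp_eq_Re)

lemma dedekind_eta_imaginary:
  assumes "y > 0"
  shows "dedekind_eta (\<i> * of_real y) = of_real (exp (- pi * y / 12 - lambert y))"
proof -
  define r where "r = exp (- 2 * pi * y)"
  have r: "0 < r" "r < 1" using assms by (auto simp: r_def)
  have q: "exp (2 * pi * \<i> * (\<i> * of_real y)) = complex_of_real r"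
  proof -
    have "2 * pi * \<i> * (\<i> * of_real y) = complex_of_real (- 2 * pi * y)"
      by (simp add: algebra_simps)
    thus ?thesis unfolding r_def by (simp only: exp_of_real)
  qed
  have "(\<lambda>N. complex_of_real (exp (- (\<Sum>n<N. - ln (1 - r ^ Suc n))))) \<longlonglongrightarrow> of_real (exp (- lambert y))"
    using lambert_eq_ln_product[OF assms] unfolding r_def sums_def by (intro tendsto_intros)
  moreover have "complex_of_real (exp (- (\<Sum>n<N. - ln (1 - r ^ Suc n)))) = (\<Prod>k\<in>{1..N}. 1 - complex_of_real r ^ k)" for N
  proof -
    have p: "1 - r ^ Suc n > 0" for n using r power_Suc_less_one[of r n] by simp
    have "exp (- (\<Sum>n<N. - ln (1 - r ^ Suc n))) = exp (\<Sum>n<N. ln (1 - r ^ Suc n))"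
      by (simp add: sum_negf)
    also have "\<dots> = (\<Prod>n<N. 1 - r ^ Suc n)"
      unfolding exp_sum[OF finite_lessThan] by (intro prod.cong refl exp_ln p)
    also have "\<dots> = (\<Prod>k\<in>{1..N}. 1 - r ^ k)"
      by (intro prod.reindex_bij_witness[of _ "\<lambda>k. k - 1" Suc]) auto
    finally show ?thesis by simp
  qed
  ultimately have "(\<lambda>N. \<Prod>k\<in>{1..N}. 1 - complex_of_real r ^ k) \<longlonglongrightarrow> of_real (exp (- lambert y))"
    by (simp only:)
  moreover have "(\<lambda>N. \<Prod>k\<in>{1..N}. 1 - complex_of_real r ^ k) \<longlonglongrightarrow> euler_fun (of_real r)"
    using r by (intro euler_product) simp
  ultimately have "euler_fun (of_real r) = of_real (exp (- lambert y))"
    using LIMSEQ_unique by blast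
  moreover have "exp (pi * \<i> * (\<i> * of_real y) / 12) = complex_of_real (exp (- pi * y / 12))"
  proof -
    have "pi * \<i> * (\<i> * of_real y) / 12 = complex_of_real (- pi * y / 12)"
      by (simp add: algebra_simps)
    thus ?thesis by (simp only: exp_of_real)
  qed
  ultimately show ?thesis
    unfolding dedekind_eta_def q by (simp only: of_real_mult[symmetric] exp_add[symmetric] diff_conv_add_uminus)
qed

text \<open>Twice the reciprocity law, exponentiated. The formula is squared so that the automorphy
  factor -iz is single-valued and both sides are holomorphic in z.\<close>

lemma dedekind_eta_inversion_rational:
  assumes "a > 0" "b > 0"
  defines "z \<equiv> \<i> * of_real (real a / real b)"
  shows "dedekind_eta (- 1 / z) ^ 2 = - \<i> * z * dedekind_eta z ^ 2"
proof -
  define y where "y = real a / real b"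
  have y: "y > 0" using assms by (simp add: y_def)
  have z: "z = \<i> * of_real y" by (simp add: z_def y_def)
  have z': "- 1 / z = \<i> * of_real (1 / y)" using y by (simp add: z field_simps)
  have "lambert y - pi / (12 * y) - (lambert (1 / y) - pi * y / 12) = ln y / 2"
    using lambert_reciprocity_rational[OF assms(1,2)] by (simp only: y_def)
  hence "2 * (- pi * (1 / y) / 12 - lambert (1 / y)) = ln y + 2 * (- pi * y / 12 - lambert y)"
    using y by (simp add: field_simps)
  hence "exp (- pi * (1 / y) / 12 - lambert (1 / y)) ^ 2 = y * exp (- pi * y / 12 - lambert y) ^ 2"
    using y by (simp only: exp_double[symmetric] exp_add exp_ln)
  hence "complex_of_real (exp (- pi * (1 / y) / 12 - lambert (1 / y)) ^ 2) =
      complex_of_real (y * exp (- pi * y / 12 - lambert y) ^ 2)" by (simp only:)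
  thus ?thesis using y unfolding z' unfolding z
    by (simp only: dedekind_eta_imaginary zero_less_divide_1_iff of_real_mult of_real_power) simp
qed

lemma holomorphic_dedekind_eta: "dedekind_eta holomorphic_on {z. Im z > 0}"
proof -
  have "(euler_fun \<circ> (\<lambda>z. exp (2 * pi * \<i> * z))) holomorphic_on {z. Im z > 0}"
  proof (rule holomorphic_on_compose_gen[OF _ holomorphic_euler_fun])
    show "(\<lambda>z. exp (2 * pi * \<i> * z)) ` {z. Im z > 0} \<subseteq> ball 0 1"
      by (auto simp: norm_nome)
  qed (intro holomorphic_intros)
  thus ?thesis unfolding dedekind_eta_def o_def by (intro holomorphic_intros) auto
qed

lemma Im_minus_inverse: "Im (- 1 / z) = Im z / (norm z)\<^sup>2"
  by (simp add: Im_divide cmod_power2)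

lemma dedekind_eta_inversion:
  assumes "Im z > 0"
  shows "dedekind_eta (- 1 / z) ^ 2 = - \<i> * z * dedekind_eta z ^ 2"
proof -
  define H where "H = {z. Im z > 0}"
  \<comment> \<open>Points of the imaginary axis with rational height, distinct from
    \<open>\<i>\<close> but converging to it: the set on which the rational case feeds the identity
    theorem.\<close>
  define f where "f n = \<i> * of_real (real (Suc (Suc n)) / real (Suc n))" for n
  have "dedekind_eta (- 1 / z) ^ 2 - (- \<i> * z * dedekind_eta z ^ 2) = 0"
  proof (rule analytic_continuation[where S = H and U = "range f" and \<xi> = \<i> and w = z
        and f = "\<lambda>z. dedekind_eta (- 1 / z) ^ 2 - (- \<i> * z * dedekind_eta z ^ 2)"])
    have "(dedekind_eta \<circ> (\<lambda>z. - 1 / z)) holomorphic_on H"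
    proof (rule holomorphic_on_compose_gen[OF _ holomorphic_dedekind_eta])
      show "(\<lambda>z. - 1 / z) ` H \<subseteq> {z. Im z > 0}"
      proof (rule image_subsetI)
        fix w assume "w \<in> H"
        hence "Im w > 0" "w \<noteq> 0" by (auto simp: H_def)
        thus "- 1 / w \<in> {z. Im z > 0}"
          unfolding mem_Collect_eq Im_minus_inverse by (intro divide_pos_pos) auto
      qed
    qed (auto intro!: holomorphic_intros simp: H_def)
    thus "(\<lambda>z. dedekind_eta (- 1 / z) ^ 2 - (- \<i> * z * dedekind_eta z ^ 2)) holomorphic_on H"
      using holomorphic_dedekind_eta unfolding o_def H_def[symmetric] by (intro holomorphic_intros)
    show "open H" "connected H"
      unfolding H_def by (auto simp: open_halfspace_Im_gt intro!: convex_connected convex_halfspace_Im_gt)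
    show "range f \<subseteq> H" "\<i> \<in> H" by (auto simp: f_def H_def)
    show "z \<in> H" using assms by (simp add: H_def)
    show "\<i> islimpt range f"
      unfolding islimpt_sequential
    proof (intro exI conjI allI)
      fix n show "f n \<in> range f - {\<i>}"
        by (auto simp: f_def complex_eq_iff)
    next
      have "(\<lambda>n. 1 + 1 / real (Suc n)) \<longlonglongrightarrow> 1 + 0"
        by (intro tendsto_intros LIMSEQ_Suc[OF lim_1_over_n])
      moreover have "1 + 1 / real (Suc n) = real (Suc (Suc n)) / real (Suc n)" for n
        by (simp add: field_simps)
      ultimately have "(\<lambda>n. real (Suc (Suc n)) / real (Suc n)) \<longlonglongrightarrow> 1"
        by (simp only: add_0_right)
      hence "(\<lambda>n. \<i> * of_real (real (Suc (Suc n)) / real (Suc n))) \<longlonglongrightarrow> \<i> * complex_of_real 1"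
        by (intro tendsto_intros)
      thus "f \<longlonglongrightarrow> \<i>" by (simp only: f_def[abs_def] of_real_1 mult_1_right)
    qed
    fix w assume "w \<in> range f"
    then obtain n where w: "w = \<i> * of_real (real (Suc (Suc n)) / real (Suc n))"
      by (auto simp only: f_def)
    show "dedekind_eta (- 1 / w) ^ 2 - (- \<i> * w * dedekind_eta w ^ 2) = 0"
      using dedekind_eta_inversion_rational[of "Suc (Suc n)" "Suc n"] unfolding w
      by (simp only: zero_less_Suc diff_self)
  qed
  thus ?thesis by (simp only: right_minus_eq)
qed

section \<open>A modular invariant and its upper bound\<close>

definition eta_height :: "complex \<Rightarrow> real" where
  "eta_height z = Im z * norm (dedekind_eta z) ^ 4"

text \<open>Under inversion Im z is divided by |z|^2, while the fourth power of |eta| is multiplied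
  by |z|^2.\<close>

lemma eta_height_inversion:
  assumes "Im z > 0"
  shows "eta_height (- 1 / z) = eta_height z"
proof -
  have z: "norm z > 0" using assms by auto
  have "norm (dedekind_eta (- 1 / z) ^ 2) = norm z * norm (dedekind_eta z ^ 2)"
    by (simp only: dedekind_eta_inversion[OF assms] norm_mult) simp
  hence "norm (dedekind_eta (- 1 / z)) ^ 2 = norm z * norm (dedekind_eta z) ^ 2"
    by (simp only: norm_power)
  hence "(norm (dedekind_eta (- 1 / z)) ^ 2) ^ 2 = (norm z * norm (dedekind_eta z) ^ 2) ^ 2"
    by (simp only:)
  hence "norm (dedekind_eta (- 1 / z)) ^ 4 = (norm z)\<^sup>2 * norm (dedekind_eta z) ^ 4"
    by (simp add: power_mult_distrib flip: power_mult)
  thus ?thesis using z by (simp add: eta_height_def Im_minus_inverse del: divide_minus_left)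
qed

text \<open>Translation changes eta only by the root of unity exp(pi i k / 12), which the norm
  removes.\<close>

lemma eta_height_translation: "eta_height (z + of_int k) = eta_height z"
proof -
  have "exp (2 * pi * \<i> * (z + of_int k)) = exp (2 * pi * \<i> * z)"
    unfolding exp_eq by (intro exI[of _ k]) (simp add: algebra_simps)
  thus ?thesis by (simp add: eta_height_def norm_dedekind_eta)
qed

text \<open>For Im z >= 1/2 the Euler product estimate applies. A lower point is first translated to
  |Re w| <= 1/2; then |w|^2 <= 1/2, so inversion at least doubles the imaginary part. Hence the
  induction on n under the condition Im z >= (1/2)^(n+1).\<close>

lemma eta_height_le:
  assumes "Im z > 0"
  shows "eta_height z \<le> exp (1 / (1 - exp (- pi))) ^ 4"
proof -
  define B where "B = exp (1 / (1 - exp (- pi)))"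
  have base: "eta_height z \<le> B ^ 4" if "Im z \<ge> 1/2" for z
  proof -
    let ?f = "norm (euler_fun (exp (2 * pi * \<i> * z)))"
    have "?f \<le> B" unfolding B_def
      using that by (intro norm_euler_fun_le) (auto simp: norm_nome)
    hence f: "?f ^ 4 \<le> B ^ 4" by (intro power_mono) auto
    \<comment> \<open>The fourth power of the prefactor of eta is exp(-pi y / 3), which beats y
      because pi / 3 > 1.\<close>
    have "Im z * exp (- pi * Im z / 12) ^ 4 \<le> 1"
    proof -
      have "Im z \<le> exp (Im z)" using exp_ge_add_one_self[of "Im z"] by linarith
      also have "\<dots> \<le> exp (pi * Im z / 3)" using that pi_gt3 by simp
      finally have "Im z * exp (- (pi * Im z / 3)) \<le> exp (pi * Im z / 3) * exp (- (pi * Im z / 3))"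
        by (intro mult_right_mono) auto
      also have "\<dots> = 1" by (simp flip: exp_add)
      also have "exp (- (pi * Im z / 3)) = exp (- pi * Im z / 12) ^ 4"
        by (simp flip: exp_of_nat_mult)
      finally show ?thesis .
    qed
    hence "(Im z * exp (- pi * Im z / 12) ^ 4) * ?f ^ 4 \<le> 1 * B ^ 4"
      using f by (intro mult_mono) auto
    thus ?thesis by (simp add: eta_height_def norm_dedekind_eta power_mult_distrib mult.assoc)
  qed
  have "eta_height z \<le> B ^ 4" if "Im z > 0" "Im z \<ge> (1/2) ^ Suc n" for n z
    using that
  proof (induction n arbitrary: z)
    case 0
    thus ?case using base by simp
  next
    case (Suc n)
    show ?case
    proof (cases "Im z \<ge> 1/2")
      case True
      thus ?thesis by (rule base)
    next
      case False
      define w where "w = z + of_int (- round (Re z))"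
      have Im: "Im w = Im z" by (simp add: w_def)
      have "\<bar>Re w\<bar> \<le> 1/2"
        using of_int_round_abs_le[of "Re z"] by (simp add: w_def abs_minus_commute)
      hence "\<bar>Re w\<bar>\<^sup>2 \<le> (1/2)\<^sup>2" by (intro power_mono) auto
      hence "(Re w)\<^sup>2 \<le> (1/2)\<^sup>2" by simp
      moreover have "(Im w)\<^sup>2 \<le> (1/2)\<^sup>2"
        using False Suc.prems by (intro power_mono) (auto simp: Im)
      ultimately have "(norm w)\<^sup>2 \<le> 1/2" by (simp add: cmod_power2 power_divide)
      moreover have "norm w > 0" using Im Suc.prems by auto
      ultimately have "Im w / (1/2) \<le> Im (- 1 / w)"
        unfolding Im_minus_inverse using Im Suc.prems by (intro divide_left_mono) auto
      hence "2 * Im z \<le> Im (- 1 / w)" using Im by simp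
      moreover have "(1/2) ^ Suc n \<le> 2 * Im z" using Suc.prems(2) by simp
      ultimately have "eta_height (- 1 / w) \<le> B ^ 4"
        using Suc.prems by (intro Suc.IH) auto
      moreover have "eta_height (- 1 / w) = eta_height z"
        using Im Suc.prems eta_height_inversion[of w] eta_height_translation[of z "- round (Re z)"]
        by (simp only: w_def)
      ultimately show ?thesis by simp
    qed
  qed
  moreover obtain n where "(1/2) ^ n < Im z"
    using real_arch_pow_inv[of "Im z" "1/2"] assms by auto
  moreover have "(1/2) ^ Suc n \<le> (1/2::real) ^ n" by simp
  ultimately show ?thesis using assms unfolding B_def by (meson less_imp_le order_trans)
qed

text \<open>The argument is exp(2 pi i z) at z = -x + i t / (2 pi). For t <= 1 the fourth root of
  \<open>eta_height_le\<close> gives t^(-1/4); for t > 1 the first-order zero at q = 0 gives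
  exp(-t), half of whose exponent is spent on absorbing t^(1/4).\<close>

lemma euler_fun_bound:
  obtains C :: real where "C > 0"
    "\<And>x t. t > 0 \<Longrightarrow> norm (euler_fun (exp (- (2 * pi * \<i> * of_real x) - of_real t)) - 1) \<le> C * (t powr (-1/4) * exp (- t / 2))"
proof -
  define B where "B = exp (1 / (1 - exp (- pi)))"
  define K where "K = exp (1 / (1 - exp (-1))) / exp (- 1 :: real)"
  \<comment> \<open>The first summand serves t <= 1, with exp(1/2) making up for exp(-t/2); the
    second serves t > 1.\<close>
  define C where "C = (1 + B * exp 1 * (2 * pi) powr (1/4)) * exp (1/2) + 2 * K"
  have BK: "B > 0" "K > 0" by (simp_all add: B_def K_def)
  have C: "C > 0" using BK by (auto simp: C_def intro!: add_pos_pos mult_pos_pos)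
  have "norm (euler_fun (exp (- (2 * pi * \<i> * of_real x) - of_real t)) - 1) \<le> C * (t powr (-1/4) * exp (- t / 2))"
    if t: "t > 0" for x t
  proof -
    define q where "q = exp (- (2 * pi * \<i> * of_real x) - of_real t)"
    have nq: "norm q = exp (- t)" by (simp add: q_def norm_exp_eq_Re)
    have pos: "t powr (-1/4) * exp (- t / 2) > 0" using t by simp
    show ?thesis unfolding q_def[symmetric]
    proof (cases "t \<le> 1")
      case True
      define y where "y = t / (2 * pi)"
      define z where "z = Complex (- x) y"
      have y: "y > 0" using t by (simp add: y_def)
      have "2 * pi * \<i> * z = - (2 * pi * \<i> * of_real x) - of_real t"
        by (simp add: z_def complex_eq_iff y_def)
      hence qz: "q = exp (2 * pi * \<i> * z)" unfolding q_def by (simp only:)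
      define f where "f = norm (euler_fun q)"
      have "y * (exp (- pi * y / 12) * f) ^ 4 \<le> B ^ 4"
        using eta_height_le[of z] y unfolding eta_height_def norm_dedekind_eta qz[symmetric] f_def B_def
        by (simp add: z_def)
      moreover have "y = (y powr (1/4)) ^ 4" using y by (simp add: powr_powr flip: powr_realpow)
      ultimately have "(y powr (1/4) * (exp (- pi * y / 12) * f)) ^ 4 \<le> B ^ 4"
        unfolding power_mult_distrib[of "y powr (1/4)"] by metis
      hence 1: "y powr (1/4) * (exp (- pi * y / 12) * f) \<le> B"
        using BK by (subst (asm) power_mono_iff) (auto simp: f_def)
      have "f = y powr (-1/4) * exp (pi * y / 12) * (y powr (1/4) * (exp (- pi * y / 12) * f))"
      proof -
        have "y powr (-1/4) * y powr (1/4) = 1" using y by (simp flip: powr_add)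
        moreover have "exp (pi * y / 12) * exp (- pi * y / 12) = 1" by (simp flip: exp_add)
        ultimately have "(y powr (-1/4) * y powr (1/4)) * (exp (pi * y / 12) * exp (- pi * y / 12)) * f = f" by simp
        thus ?thesis by (simp only: mult_ac)
      qed
      also have "\<dots> \<le> y powr (-1/4) * exp 1 * B"
      proof (intro mult_mono 1)
        have "pi * y / 12 = t / 24" by (simp add: y_def)
        thus "exp (pi * y / 12) \<le> exp 1" using True by simp
      qed (auto simp: f_def)
      also have "y powr (-1/4) = t powr (-1/4) * (2 * pi) powr (1/4)"
        using t by (simp add: y_def powr_divide powr_minus field_simps)
      finally have f: "f \<le> t powr (-1/4) * (B * exp 1 * (2 * pi) powr (1/4))"
        by (simp add: mult_ac)
      \<comment> \<open>For t <= 1 the weight t^(-1/4) absorbs the 1 that is subtracted from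
        \<open>euler_fun q\<close>.\<close>
      have t1: "1 \<le> t powr (-1/4)" using t True by (simp add: ge_one_powr_ge_zero powr_minus powr_le1 one_le_inverse_iff)
      have "norm (euler_fun q - 1) \<le> f + 1"
        using norm_triangle_ineq4[of "euler_fun q" 1] by (simp add: f_def)
      also have "\<dots> \<le> t powr (-1/4) * (1 + B * exp 1 * (2 * pi) powr (1/4))"
        using f t1 by (simp add: distrib_left)
      also have "\<dots> \<le> t powr (-1/4) * (1 + B * exp 1 * (2 * pi) powr (1/4)) * (exp (1/2) * exp (- t / 2))"
      proof -
        have "1 \<le> exp (1/2) * exp (- t / 2)" using True by (simp flip: exp_add)
        hence "t powr (-1/4) * (1 + B * exp 1 * (2 * pi) powr (1/4)) * 1 \<le> t powr (-1/4) * (1 + B * exp 1 * (2 * pi) powr (1/4)) * (exp (1/2) * exp (- t / 2))"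
          using BK by (intro mult_left_mono) auto
        thus ?thesis by (simp only: mult_1_right)
      qed
      also have "\<dots> = ((1 + B * exp 1 * (2 * pi) powr (1/4)) * exp (1/2)) * (t powr (-1/4) * exp (- t / 2))"
        by (simp only: mult_ac)
      also have "\<dots> \<le> C * (t powr (-1/4) * exp (- t / 2))"
        using pos BK by (intro mult_right_mono) (auto simp: C_def)
      finally show "norm (euler_fun q - 1) \<le> C * (t powr (-1/4) * exp (- t / 2))" .
    next
      case False
      have "norm (euler_fun q - 1) \<le> norm q * (exp (1 / (1 - exp (-1))) / exp (-1))"
        using False by (intro norm_euler_fun_minus_one_le) (auto simp: nq)
      also have "\<dots> = K * exp (- t)" by (simp add: K_def nq)
      also have "exp (- t) \<le> 2 * (t powr (-1/4) * exp (- t / 2))"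
      proof -
        have "t powr (1/4) \<le> t powr 1" using False by (intro powr_mono) auto
        also have "t powr 1 = t" using t by simp
        also have "t \<le> 2 * exp (t / 2)" using exp_ge_add_one_self[of "t/2"] by linarith
        finally have "t powr (1/4) * (t powr (-1/4) * exp (- t)) \<le> 2 * exp (t / 2) * (t powr (-1/4) * exp (- t))"
          by (intro mult_right_mono) auto
        moreover have "t powr (1/4) * t powr (-1/4) = 1" using t by (simp flip: powr_add)
        moreover have "exp (t / 2) * exp (- t) = exp (- t / 2)" by (simp flip: exp_add)
        ultimately show ?thesis by (metis mult.assoc mult.left_commute mult_1)
      qed
      hence "K * exp (- t) \<le> 2 * K * (t powr (-1/4) * exp (- t / 2))"
        using BK by simp
      also have "\<dots> \<le> C * (t powr (-1/4) * exp (- t / 2))"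
        using pos BK by (intro mult_right_mono) (auto simp: C_def)
      finally show "norm (euler_fun q - 1) \<le> C * (t powr (-1/4) * exp (- t / 2))" .
    qed
  qed
  thus ?thesis using C that by blast
qed

section \<open>Fourier sums and the Mellin integral\<close>

lemma has_integral_exp_period:
  "((\<lambda>x. exp (2 * pi * \<i> * of_int k * of_real x)) has_integral (if k = 0 then 1 else 0)) {0..1::real}"
proof (cases "k = 0")
  case True
  thus ?thesis using has_integral_const_real[of "1 :: complex" 0 1] by simp
next
  case False
  define c where "c = 2 * pi * \<i> * of_int k"
  have c: "c \<noteq> 0" using False by (simp add: c_def)
  have "((\<lambda>x. exp (c * of_real x)) has_integral (exp (c * of_real 1) / c - exp (c * of_real 0) / c)) {0..1::real}"
  proof (rule fundamental_theorem_of_calculus)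
    fix x :: real
    have "((\<lambda>z. exp (c * z) / c) has_field_derivative exp (c * of_real x)) (at (of_real x))"
      using c by (auto intro!: derivative_eq_intros)
    thus "((\<lambda>x. exp (c * of_real x) / c) has_vector_derivative exp (c * of_real x)) (at x within {0..1})"
      by (rule has_vector_derivative_real_field)
  qed simp
  moreover have "exp c = 1" unfolding exp_eq_1 c_def by (auto intro!: exI[of _ k])
  ultimately show ?thesis using False by (simp add: c_def)
qed

text \<open>Expanding the square leaves only the diagonal terms, by orthogonality of the
  exponentials. An arbitrary finite index set covers the remainders with indices {1..M} -
  {1..N}.\<close>

lemma parseval_finite:
  fixes c :: "nat \<Rightarrow> complex"
  assumes "finite A"
  shows "(\<integral>\<^sup>+x. ennreal (indicator {0..1} x * (norm (\<Sum>n\<in>A. c n * exp (- 2 * pi * \<i> * of_nat n * of_real x)))\<^sup>2) \<partial>lborel)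
           = ennreal (\<Sum>n\<in>A. (norm (c n))\<^sup>2)"
proof -
  let ?S = "\<lambda>x::real. \<Sum>n\<in>A. c n * exp (- 2 * pi * \<i> * of_nat n * of_real x)"
  have "((\<lambda>x. \<Sum>n\<in>A. \<Sum>m\<in>A. c n * cnj (c m) * exp (2 * pi * \<i> * of_int (int m - int n) * of_real x)) has_integral
          (\<Sum>n\<in>A. \<Sum>m\<in>A. c n * cnj (c m) * (if int m - int n = 0 then 1 else 0))) {0..1}"
    by (intro has_integral_sum has_integral_mult_right has_integral_exp_period assms)
  moreover have "(\<Sum>n\<in>A. \<Sum>m\<in>A. c n * cnj (c m) * exp (2 * pi * \<i> * of_int (int m - int n) * of_real x)) = of_real ((norm (?S x))\<^sup>2)" for x
  proof -
    have "exp (2 * pi * \<i> * of_int (int m - int n) * of_real x) =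
       exp (- 2 * pi * \<i> * of_nat n * of_real x) * cnj (exp (- 2 * pi * \<i> * of_nat m * of_real x))" for m n
      by (simp add: exp_cnj algebra_simps flip: exp_add)
    thus ?thesis unfolding complex_norm_square
      by (simp add: sum_product mult_ac)
  qed
  moreover have "(\<Sum>n\<in>A. \<Sum>m\<in>A. c n * cnj (c m) * (if int m - int n = 0 then 1 else 0)) = of_real (\<Sum>n\<in>A. (norm (c n))\<^sup>2)"
  proof -
    have "(\<Sum>m\<in>A. c n * cnj (c m) * (if int m - int n = 0 then 1 else 0)) = of_real ((norm (c n))\<^sup>2)" if "n \<in> A" for n
    proof -
      have "(\<Sum>m\<in>A. c n * cnj (c m) * (if int m - int n = 0 then 1 else 0)) = (\<Sum>m\<in>A. if m = n then c n * cnj (c n) else 0)"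
        by (intro sum.cong) auto
      also have "\<dots> = c n * cnj (c n)" using that assms by simp
      finally show ?thesis by (simp only: complex_norm_square)
    qed
    thus ?thesis by simp
  qed
  ultimately have "((\<lambda>x. complex_of_real ((norm (?S x))\<^sup>2)) has_integral of_real (\<Sum>n\<in>A. (norm (c n))\<^sup>2)) {0..1}"
    by (simp only:)
  from has_integral_linear[OF this bounded_linear_Re]
  have "((\<lambda>x. (norm (?S x))\<^sup>2) has_integral (\<Sum>n\<in>A. (norm (c n))\<^sup>2)) {0..1}"
    by (simp only: o_def Re_complex_of_real)
  from nn_integral_has_integral_lebesgue[OF _ this] show ?thesis by simp
qed

lemma nn_integral_gamma_weight:
  fixes a c :: real
  assumes "a > 0" "c > 0"
  shows "(\<integral>\<^sup>+t. ennreal (indicator {0<..} t * (t powr (a - 1) * exp (- c * t))) \<partial>lborel) = ennreal (Gamma a / c powr a)"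
proof -
  let ?w = "\<lambda>t. ennreal (indicator {0<..} t * (t powr (a - 1) * exp (- c * t)))"
  have "ennreal (Gamma a) = (\<integral>\<^sup>+t. ennreal (indicator {0..} t * t powr (a - 1) / exp t) \<partial>lborel)"
    by (rule Gamma_conv_nn_integral_real[OF assms(1)])
  also have "\<dots> = ennreal \<bar>c\<bar> * (\<integral>\<^sup>+t. ennreal (indicator {0..} (0 + c * t) * (0 + c * t) powr (a - 1) / exp (0 + c * t)) \<partial>lborel)"
    using assms by (intro nn_integral_real_affine) auto
  also have "(\<integral>\<^sup>+t. ennreal (indicator {0..} (0 + c * t) * (0 + c * t) powr (a - 1) / exp (0 + c * t)) \<partial>lborel)
      = (\<integral>\<^sup>+t. ennreal (c powr (a - 1)) * ?w t \<partial>lborel)"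
  proof (intro nn_integral_cong)
    fix t :: real
    show "ennreal (indicator {0..} (0 + c * t) * (0 + c * t) powr (a - 1) / exp (0 + c * t)) = ennreal (c powr (a - 1)) * ?w t"
    proof (cases "t > 0")
      case True
      thus ?thesis using assms
        by (subst ennreal_mult'[symmetric]) (auto simp: powr_mult exp_minus field_simps)
    next
      case False
      \<comment> \<open>At t = 0 the convention \<open>0 powr (a - 1) = 0\<close> reconciles the
        closed half-line of the Gamma integral with the open one.\<close>
      thus ?thesis using assms by (cases "t = 0") (auto simp: indicator_def zero_le_mult_iff)
    qed
  qed
  also have "\<dots> = ennreal (c powr (a - 1)) * (\<integral>\<^sup>+t. ?w t \<partial>lborel)"
    by (intro nn_integral_cmult) measurable
  finally have G: "ennreal (Gamma a) = ennreal (c powr a) * (\<integral>\<^sup>+t. ?w t \<partial>lborel)"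
  proof -
    assume h: "ennreal (Gamma a) = ennreal \<bar>c\<bar> * (ennreal (c powr (a - 1)) * (\<integral>\<^sup>+t. ?w t \<partial>lborel))"
    have "c * c powr (a - 1) = c powr a" using assms by (simp add: powr_diff)
    hence "ennreal \<bar>c\<bar> * ennreal (c powr (a - 1)) = ennreal (c powr a)"
      using assms by (subst ennreal_mult[symmetric]) auto
    thus ?thesis using h by (simp only: mult.assoc[symmetric])
  qed
  have "ennreal (Gamma a / c powr a) = ennreal (1 / c powr a) * ennreal (Gamma a)"
    using assms by (subst ennreal_mult'[symmetric]) auto
  also have "\<dots> = (ennreal (1 / c powr a) * ennreal (c powr a)) * (\<integral>\<^sup>+t. ?w t \<partial>lborel)"
    unfolding G by (simp only: mult.assoc)
  also have "ennreal (1 / c powr a) * ennreal (c powr a) = 1"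
    using assms by (subst ennreal_mult'[symmetric]) auto
  finally show ?thesis by simp
qed

section \<open>Exponentially damped Fourier sums and Bessel's inequality\<close>

definition euler_dev :: "real \<Rightarrow> real \<Rightarrow> complex" where
  "euler_dev x t = euler_fun (exp (- (2 * pi * \<i> * of_real x) - of_real t)) - 1"

text \<open>Over {1..N} these are the partial sums of \<open>euler_dev\<close>; general index sets
  also express their differences.\<close>

definition dev_sum :: "nat set \<Rightarrow> real \<Rightarrow> real \<Rightarrow> complex" where
  "dev_sum A x t = (\<Sum>n\<in>A. of_int (eta_coeff n) * of_real (exp (- (real n * t))) * exp (- 2 * pi * \<i> * of_nat n * of_real x))"

lemma measurable_euler_dev [measurable]: "case_prod euler_dev \<in> borel_measurable (lborel \<Otimes>\<^sub>M lborel)"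
  unfolding euler_dev_def euler_fun_def by measurable

lemma measurable_dev_sum [measurable]: "case_prod (dev_sum A) \<in> borel_measurable (lborel \<Otimes>\<^sub>M lborel)"
  unfolding dev_sum_def by measurable

lemma dev_sum_tendsto:
  assumes "t > 0"
  shows "(\<lambda>N. dev_sum {1..N} x t) \<longlonglongrightarrow> euler_dev x t"
proof -
  define q where "q = exp (- (2 * pi * \<i> * of_real x) - of_real t)"
  have q: "norm q < 1" using assms by (simp add: q_def norm_exp_eq_Re)
  have "(\<lambda>n. of_int (eta_coeff (Suc n)) * q ^ Suc n) sums (euler_fun q - 1)"
    using euler_fun_sums[OF q] by (subst sums_Suc_iff) (simp add: eta_coeff_def)
  hence "(\<lambda>N. \<Sum>n<N. of_int (eta_coeff (Suc n)) * q ^ Suc n) \<longlonglongrightarrow> euler_dev x t"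
    by (simp only: sums_def euler_dev_def q_def)
  moreover have "(\<Sum>n<N. of_int (eta_coeff (Suc n)) * q ^ Suc n) = dev_sum {1..N} x t" for N
  proof -
    have "q ^ n = of_real (exp (- (real n * t))) * exp (- 2 * pi * \<i> * of_nat n * of_real x)" for n
      unfolding q_def exp_of_nat_mult[symmetric] exp_of_real[symmetric] exp_add[symmetric]
      by (intro arg_cong[where f = exp]) (simp add: algebra_simps)
    hence "dev_sum {1..N} x t = (\<Sum>n\<in>{1..N}. of_int (eta_coeff n) * q ^ n)"
      by (simp only: dev_sum_def mult.assoc)
    also have "\<dots> = (\<Sum>n<N. of_int (eta_coeff (Suc n)) * q ^ Suc n)"
      by (intro sum.reindex_bij_witness[of _ Suc "\<lambda>n. n - 1"]) auto
    finally show ?thesis by simp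
  qed
  ultimately show ?thesis by (simp only:)
qed

text \<open>The bound is independent of \<open>x\<close> and \<open>A\<close>, as dominated
  convergence over [0,1] at fixed t requires.\<close>

lemma norm_dev_sum_le:
  assumes "t > 0" "finite A"
  shows "norm (dev_sum A x t) \<le> exp (1 / (1 - exp (- t)))"
proof -
  have "norm (dev_sum A x t) \<le> (\<Sum>n\<in>A. \<bar>of_int (eta_coeff n)\<bar> * exp (- t) ^ n)"
    unfolding dev_sum_def
  proof (rule sum_norm_le)
    fix n
    have "norm (exp (- 2 * pi * \<i> * of_nat n * of_real x)) = 1" by (simp add: norm_exp_eq_Re)
    moreover have "exp (- (real n * t)) = exp (- t) ^ n" by (simp flip: exp_of_nat_mult)
    ultimately show "norm (of_int (eta_coeff n) * of_real (exp (- (real n * t))) * exp (- 2 * pi * \<i> * of_nat n * of_real x))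
      \<le> \<bar>of_int (eta_coeff n)\<bar> * exp (- t) ^ n"
      by (simp only: norm_mult norm_of_int norm_of_real abs_exp_cancel mult_1_right power_abs)
  qed
  also have "\<dots> \<le> (\<Sum>n. \<bar>of_int (eta_coeff n)\<bar> * exp (- t) ^ n)"
    using assms by (intro sum_le_suminf summable_abs_eta_coeff) auto
  also have "\<dots> \<le> exp (1 / (1 - exp (- t)))"
    using assms by (intro summable_abs_eta_coeff(2)) auto
  finally show ?thesis .
qed

text \<open>Bessel's inequality for the remainder, obtained by applying
  \<open>parseval_finite\<close> to {1..M} - {1..N} and to {1..M} and letting M tend to infinity. It
  supplies a majorant independent of \<open>N\<close>.\<close>

lemma nn_integral_dev_sum_diff_le:
  assumes "t > 0"
  shows "(\<integral>\<^sup>+x. ennreal (indicator {0..1} x * (norm (euler_dev x t - dev_sum {1..N} x t))\<^sup>2) \<partial>lborel)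
           \<le> (\<integral>\<^sup>+x. ennreal (indicator {0..1} x * (norm (euler_dev x t))\<^sup>2) \<partial>lborel)"
proof -
  define K where "K = exp (1 / (1 - exp (- t)))"
  have K: "K \<ge> 0" by (simp add: K_def)
  have meas[measurable]: "(\<lambda>x. euler_dev x t) \<in> borel_measurable lborel" "(\<lambda>x. dev_sum A x t) \<in> borel_measurable lborel" for A
    by measurable
  have pv: "(\<integral>\<^sup>+x. ennreal (indicator {0..1} x * (norm (dev_sum A x t))\<^sup>2) \<partial>lborel)
      = ennreal (\<Sum>n\<in>A. (norm (of_int (eta_coeff n) * complex_of_real (exp (- (real n * t)))))\<^sup>2)" if "finite A" for A
    unfolding dev_sum_def by (rule parseval_finite[OF that])
  \<comment> \<open>Taking B = {1..N} gives the limit on the left of the inequality, and B = {} the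
    one on the right.\<close>
  have lim: "(\<lambda>M. \<integral>\<^sup>+x. ennreal (indicator {0..1} x * (norm (dev_sum ({1..M} - B) x t))\<^sup>2) \<partial>lborel)
     \<longlonglongrightarrow> (\<integral>\<^sup>+x. ennreal (indicator {0..1} x * (norm (euler_dev x t - dev_sum B x t))\<^sup>2) \<partial>lborel)"
    if B: "B \<subseteq> {1..N}" for B
  proof (rule nn_integral_dominated_convergence[where w = "\<lambda>x. ennreal (K\<^sup>2) * indicator {0..1} x"])
    show "AE x in lborel. ennreal (indicator {0..1} x * (norm (dev_sum ({1..M} - B) x t))\<^sup>2) \<le> ennreal (K\<^sup>2) * indicator {0..1} x" for M
    proof (intro AE_I2)
      fix x :: real
      have "norm (dev_sum ({1..M} - B) x t) \<le> K" unfolding K_def by (intro norm_dev_sum_le assms) auto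
      hence "(norm (dev_sum ({1..M} - B) x t))\<^sup>2 \<le> K\<^sup>2" by (intro power_mono) auto
      thus "ennreal (indicator {0..1} x * (norm (dev_sum ({1..M} - B) x t))\<^sup>2) \<le> ennreal (K\<^sup>2) * indicator {0..1} x"
        by (auto simp: indicator_def intro!: ennreal_leI)
    qed
    show "(\<integral>\<^sup>+x. ennreal (K\<^sup>2) * indicator {0..1::real} x \<partial>lborel) < \<infinity>"
      by (subst nn_integral_cmult_indicator) (auto simp: ennreal_mult_less_top)
    show "AE x in lborel. (\<lambda>M. ennreal (indicator {0..1} x * (norm (dev_sum ({1..M} - B) x t))\<^sup>2))
        \<longlonglongrightarrow> ennreal (indicator {0..1} x * (norm (euler_dev x t - dev_sum B x t))\<^sup>2)"
    proof (intro AE_I2 tendsto_ennrealI tendsto_intros)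
      fix x :: real
      have "(\<lambda>M. dev_sum {1..M} x t - dev_sum B x t) \<longlonglongrightarrow> euler_dev x t - dev_sum B x t"
        by (intro tendsto_intros dev_sum_tendsto assms)
      moreover have "\<forall>\<^sub>F M in sequentially. dev_sum {1..M} x t - dev_sum B x t = dev_sum ({1..M} - B) x t"
        using eventually_ge_at_top[of N]
      proof eventually_elim
        case (elim M)
        hence "B \<subseteq> {1..M}" using B by auto
        thus ?case unfolding dev_sum_def by (subst sum_diff) auto
      qed
      ultimately show "(\<lambda>M. dev_sum ({1..M} - B) x t) \<longlonglongrightarrow> euler_dev x t - dev_sum B x t"
        by (rule Lim_transform_eventually)
    qed
  qed measurable
  have "(\<lambda>M. \<integral>\<^sup>+x. ennreal (indicator {0..1} x * (norm (dev_sum {1..M} x t))\<^sup>2) \<partial>lborel)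
     \<longlonglongrightarrow> (\<integral>\<^sup>+x. ennreal (indicator {0..1} x * (norm (euler_dev x t))\<^sup>2) \<partial>lborel)"
    using lim[of "{}"] by (simp add: dev_sum_def)
  from lim[OF order.refl] this show ?thesis
  proof (rule LIMSEQ_le)
    have "(\<integral>\<^sup>+x. ennreal (indicator {0..1} x * (norm (dev_sum ({1..M} - {1..N}) x t))\<^sup>2) \<partial>lborel)
        \<le> (\<integral>\<^sup>+x. ennreal (indicator {0..1} x * (norm (dev_sum {1..M} x t))\<^sup>2) \<partial>lborel)" for M
      unfolding pv[OF finite_atLeastAtMost] pv[OF finite_Diff[OF finite_atLeastAtMost]]
      by (intro ennreal_leI sum_mono2) auto
    thus "\<exists>K. \<forall>M\<ge>K. (\<integral>\<^sup>+x. ennreal (indicator {0..1} x * (norm (dev_sum ({1..M} - {1..N}) x t))\<^sup>2) \<partial>lborel)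
        \<le> (\<integral>\<^sup>+x. ennreal (indicator {0..1} x * (norm (dev_sum {1..M} x t))\<^sup>2) \<partial>lborel)" by blast
  qed
qed

text \<open>At fixed t > 0 the damped series converges pointwise and stays bounded in x and N; this
  is the pointwise limit in t for \<open>m_partial_tendsto_m_fun\<close>.\<close>

lemma nn_integral_dev_sum_diff_tendsto_0:
  assumes "t > 0"
  shows "(\<lambda>N. \<integral>\<^sup>+x. ennreal (indicator {0..1} x * (norm (euler_dev x t - dev_sum {1..N} x t))\<^sup>2) \<partial>lborel) \<longlonglongrightarrow> 0"
proof -
  define K where "K = exp (1 / (1 - exp (- t)))"
  have [measurable]: "(\<lambda>x. euler_dev x t) \<in> borel_measurable lborel" "(\<lambda>x. dev_sum A x t) \<in> borel_measurable lborel" for A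
    by measurable
  have K1: "norm (dev_sum {1..N} x t) \<le> K" for N x unfolding K_def by (intro norm_dev_sum_le assms) auto
  have K2: "norm (euler_dev x t) \<le> K" for x
    by (rule Lim_bounded[OF tendsto_norm[OF dev_sum_tendsto[OF assms]], of 0]) (use K1 in auto)
  have "(\<lambda>N. \<integral>\<^sup>+x. ennreal (indicator {0..1} x * (norm (euler_dev x t - dev_sum {1..N} x t))\<^sup>2) \<partial>lborel)
          \<longlonglongrightarrow> (\<integral>\<^sup>+x. (0::ennreal) \<partial>(lborel :: real measure))"
  proof (rule nn_integral_dominated_convergence[where w = "\<lambda>x. ennreal ((2 * K)\<^sup>2) * indicator {0..1} x"])
    show "AE x in lborel. ennreal (indicator {0..1} x * (norm (euler_dev x t - dev_sum {1..N} x t))\<^sup>2) \<le> ennreal ((2 * K)\<^sup>2) * indicator {0..1} x" for N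
    proof (intro AE_I2)
      fix x :: real
      have "norm (euler_dev x t - dev_sum {1..N} x t) \<le> 2 * K"
        using norm_triangle_ineq4[of "euler_dev x t" "dev_sum {1..N} x t"] K1[of N x] K2[of x] by linarith
      hence "(norm (euler_dev x t - dev_sum {1..N} x t))\<^sup>2 \<le> (2 * K)\<^sup>2" by (intro power_mono) auto
      thus "ennreal (indicator {0..1} x * (norm (euler_dev x t - dev_sum {1..N} x t))\<^sup>2) \<le> ennreal ((2 * K)\<^sup>2) * indicator {0..1} x"
        by (auto simp: indicator_def intro!: ennreal_leI)
    qed
    show "(\<integral>\<^sup>+x. ennreal ((2 * K)\<^sup>2) * indicator {0..1::real} x \<partial>lborel) < \<infinity>"
      by (subst nn_integral_cmult_indicator) (auto simp: ennreal_mult_less_top)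
    show "AE x in lborel. (\<lambda>N. ennreal (indicator {0..1} x * (norm (euler_dev x t - dev_sum {1..N} x t))\<^sup>2)) \<longlonglongrightarrow> 0"
    proof (intro AE_I2)
      fix x :: real
      have "(\<lambda>N. ennreal (indicator {0..1} x * (norm (euler_dev x t - dev_sum {1..N} x t))\<^sup>2)) \<longlonglongrightarrow>
            ennreal (indicator {0..1} x * (norm (euler_dev x t - euler_dev x t))\<^sup>2)"
        by (intro tendsto_ennrealI tendsto_intros dev_sum_tendsto assms)
      thus "(\<lambda>N. ennreal (indicator {0..1} x * (norm (euler_dev x t - dev_sum {1..N} x t))\<^sup>2)) \<longlonglongrightarrow> 0" by simp
    qed
  qed measurable
  thus ?thesis by simp
qed

lemma has_bochner_integral_gamma_weight:
  fixes a c :: real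
  assumes "a > 0" "c > 0"
  shows "has_bochner_integral lborel (\<lambda>t. indicator {0<..} t * (t powr (a - 1) * exp (- c * t))) (Gamma a / c powr a)"
proof (rule has_bochner_integral_nn_integral)
  show "0 \<le> Gamma a / c powr a" using assms by (simp add: Gamma_real_pos less_imp_le)
  show "(\<integral>\<^sup>+t. ennreal (indicator {0<..} t * (t powr (a - 1) * exp (- c * t))) \<partial>lborel) = ennreal (Gamma a / c powr a)"
    by (rule nn_integral_gamma_weight[OF assms])
qed auto

section \<open>The Mellin representation and its boundedness\<close>

definition mellin_weight :: "real \<Rightarrow> real \<Rightarrow> real" where
  "mellin_weight s t = indicator {0<..} t * t powr (s - 1)"

lemma measurable_mellin_weight [measurable]: "mellin_weight s \<in> borel_measurable lborel"
  unfolding mellin_weight_def by measurable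

text \<open>The integral of t^(s-1) exp(-nt) is Gamma(s) n^(-s), so the Mellin transform turns the
  damping factor of each term into its coefficient n^(-s).\<close>

lemma has_bochner_integral_m_partial:
  assumes "s > 0"
  shows "has_bochner_integral lborel (\<lambda>t. of_real (mellin_weight s t) * dev_sum {1..N} x t) (of_real (Gamma s) * m_partial s N x)"
proof -
  let ?b = "\<lambda>n. of_int (eta_coeff n) * exp (- 2 * pi * \<i> * of_nat n * of_real x)"
  have "has_bochner_integral lborel
     (\<lambda>t. \<Sum>n\<in>{1..N}. ?b n * of_real (indicator {0<..} t * (t powr (s - 1) * exp (- real n * t))))
     (\<Sum>n\<in>{1..N}. ?b n * of_real (Gamma s / real n powr s))"
    using assms
    by (intro has_bochner_integral_sum has_bochner_integral_mult_right has_bochner_integral_of_real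
          has_bochner_integral_gamma_weight) auto
  moreover have "(\<Sum>n\<in>{1..N}. ?b n * of_real (indicator {0<..} t * (t powr (s - 1) * exp (- real n * t))))
      = of_real (mellin_weight s t) * dev_sum {1..N} x t" for t
    unfolding dev_sum_def mellin_weight_def sum_distrib_left
    by (intro sum.cong refl) (simp add: mult_ac)
  moreover have "(\<Sum>n\<in>{1..N}. ?b n * of_real (Gamma s / real n powr s)) = of_real (Gamma s) * m_partial s N x"
    unfolding m_partial_def sum_distrib_left by (intro sum.cong refl) simp
  ultimately show ?thesis by (simp only:)
qed

text \<open>A representative of m_{s,f} given by a formula at every point x, which makes a pointwise
  bound possible.\<close>

definition m_fun :: "real \<Rightarrow> real \<Rightarrow> complex" where
  "m_fun s x = (\<integral>t. of_real (mellin_weight s t) * euler_dev x t \<partial>lborel) / of_real (Gamma s)"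

lemma measurable_m_fun [measurable]: "m_fun s \<in> borel_measurable lborel"
  unfolding m_fun_def by measurable

text \<open>By \<open>euler_fun_bound\<close> the integrand is O(t^(s - 5/4)) near 0, integrable
  because s > 1/4, and exp(-t/2) controls infinity. The majorant does not depend on x, so it yields
  both integrability and the uniform bound.\<close>

lemma
  assumes "s > 1/4"
  shows integrable_mellin_euler_dev: "integrable lborel (\<lambda>t. of_real (mellin_weight s t) * euler_dev x t)"
    and m_fun_bounded: "\<exists>B>0. \<forall>x. norm (m_fun s x) \<le> B"
proof -
  obtain C where C: "C > 0"
    "\<And>x t. t > 0 \<Longrightarrow> norm (euler_dev x t) \<le> C * (t powr (-1/4) * exp (- t / 2))"
    using euler_fun_bound unfolding euler_dev_def by blast
  define G where "G = Gamma (s - 1/4) / (1/2) powr (s - 1/4)"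
  have G: "G > 0" using assms by (auto simp: G_def intro!: divide_pos_pos Gamma_real_pos)
  let ?w = "\<lambda>t. C * (indicator {0<..} t * (t powr ((s - 1/4) - 1) * exp (- (1/2) * t)))"
  have int: "has_bochner_integral lborel ?w (C * G)"
    unfolding G_def using assms by (intro has_bochner_integral_mult_right has_bochner_integral_gamma_weight) auto
  have bd: "norm (of_real (mellin_weight s t) * euler_dev x t) \<le> ?w t" for x t
  proof (cases "t > 0")
    case True
    have "norm (of_real (mellin_weight s t) * euler_dev x t) = t powr (s - 1) * norm (euler_dev x t)"
      using True by (simp add: mellin_weight_def norm_mult)
    also have "\<dots> \<le> t powr (s - 1) * (C * (t powr (-1/4) * exp (- t / 2)))"
      using C(2)[OF True] by (intro mult_left_mono) auto
    also have "\<dots> = C * ((t powr (s - 1) * t powr (-1/4)) * exp (- t / 2))" by (simp only: mult_ac)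
    also have "t powr (s - 1) * t powr (-1/4) = t powr ((s - 1/4) - 1)"
      using True by (simp add: algebra_simps flip: powr_add)
    finally show ?thesis using True by simp
  qed (simp add: mellin_weight_def)
  show int': "integrable lborel (\<lambda>t. of_real (mellin_weight s t) * euler_dev x t)" for x
  proof (rule Bochner_Integration.integrable_bound)
    show "integrable lborel ?w" using int by (simp only: has_bochner_integral_iff)
    show "(\<lambda>t. of_real (mellin_weight s t) * euler_dev x t) \<in> borel_measurable lborel" by measurable
    show "AE t in lborel. norm (of_real (mellin_weight s t) * euler_dev x t) \<le> norm (?w t)"
      using bd by (intro AE_I2) (smt (verit) real_norm_def)
  qed
  show "\<exists>B>0. \<forall>x. norm (m_fun s x) \<le> B"
  proof (intro exI conjI allI)
    show "C * G / Gamma s > 0" using C G assms by (intro divide_pos_pos mult_pos_pos Gamma_real_pos) auto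
    fix x
    have "norm (\<integral>t. of_real (mellin_weight s t) * euler_dev x t \<partial>lborel) \<le> (\<integral>t. ?w t \<partial>lborel)"
      using bd int by (intro Bochner_Integration.integral_norm_bound_integral int') (auto simp: has_bochner_integral_iff)
    also have "\<dots> = C * G" using int by (simp only: has_bochner_integral_iff)
    finally show "norm (m_fun s x) \<le> C * G / Gamma s"
      using assms by (simp add: m_fun_def norm_divide divide_right_mono Gamma_real_pos less_imp_le abs_of_pos)
  qed
qed

text \<open>Cauchy--Schwarz against the weight \<open>t powr (s - 5/4) * exp (- t / 2)\<close>, which matches the
  bound of \<open>euler_fun_bound\<close> and is integrable exactly because \<open>s > 1/4\<close>.\<close>
lemma m_partial_minus_m_fun_le:
  assumes "s > 1/4"
  defines "c \<equiv> Gamma (s - 1/4) / (1/2) powr (s - 1/4) / (Gamma s)\<^sup>2"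
  shows "ennreal ((norm (m_partial s N x - m_fun s x))\<^sup>2) \<le>
     ennreal c * (\<integral>\<^sup>+t. ennreal (indicator {0<..} t * (t powr (s - 3/4) * exp (t / 2)) * (norm (euler_dev x t - dev_sum {1..N} x t))\<^sup>2) \<partial>lborel)"
proof -
  define D where "D t = euler_dev x t - dev_sum {1..N} x t" for t
  have [measurable]: "D \<in> borel_measurable lborel" unfolding D_def by measurable
  define I where "I = (\<integral>t. of_real (mellin_weight s t) * D t \<partial>lborel)"
  \<comment> \<open>\<open>A\<close> and \<open>B\<close> split the weight t^(s-1) for
    Cauchy-Schwarz: the exponents of t add up to s - 1 and the exponentials cancel. The square of
    \<open>B\<close> is the integrable weight, and the square of \<open>A\<close> carries the
    remainder.\<close>
  define A where "A t = ennreal (indicator {0<..} t * (t powr ((s - 3/4) / 2) * exp (t / 4)) * norm (D t))" for t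
  define B where "B t = ennreal (indicator {0<..} t * (t powr ((s - 5/4) / 2) * exp (- t / 4)))" for t
  have [measurable]: "A \<in> borel_measurable lborel" "B \<in> borel_measurable lborel"
    unfolding A_def B_def by measurable
  have Gs: "Gamma s > 0" using assms by (intro Gamma_real_pos) auto
  have hp: "has_bochner_integral lborel (\<lambda>t. of_real (mellin_weight s t) * dev_sum {1..N} x t) (of_real (Gamma s) * m_partial s N x)"
    using assms by (intro has_bochner_integral_m_partial) auto
  have int: "integrable lborel (\<lambda>t. of_real (mellin_weight s t) * D t)"
    unfolding D_def right_diff_distrib
    using hp by (intro Bochner_Integration.integrable_diff integrable_mellin_euler_dev assms) (simp add: has_bochner_integral_iff)
  have "I = of_real (Gamma s) * m_fun s x - of_real (Gamma s) * m_partial s N x"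
  proof -
    have "I = (\<integral>t. of_real (mellin_weight s t) * euler_dev x t \<partial>lborel) - (\<integral>t. of_real (mellin_weight s t) * dev_sum {1..N} x t \<partial>lborel)"
      unfolding I_def D_def right_diff_distrib using hp
      by (intro Bochner_Integration.integral_diff integrable_mellin_euler_dev assms) (simp add: has_bochner_integral_iff)
    thus ?thesis using hp Gs by (simp add: has_bochner_integral_iff m_fun_def)
  qed
  hence "m_partial s N x - m_fun s x = - I / of_real (Gamma s)"
    using Gs by (simp add: field_simps)
  hence "norm (m_partial s N x - m_fun s x) = norm I / Gamma s"
    using Gs by (simp add: norm_divide)
  hence 1: "ennreal ((norm (m_partial s N x - m_fun s x))\<^sup>2) = ennreal (1 / (Gamma s)\<^sup>2) * (ennreal (norm I))\<^sup>2"
    by (simp add: power_divide ennreal_power flip: ennreal_mult)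
  have "ennreal (norm I) \<le> (\<integral>\<^sup>+t. ennreal (norm (of_real (mellin_weight s t) * D t)) \<partial>lborel)"
    unfolding I_def by (rule integral_norm_bound_ennreal[OF int])
  also have "\<dots> = (\<integral>\<^sup>+t. A t * B t \<partial>lborel)"
  proof (intro nn_integral_cong)
    fix t :: real
    show "ennreal (norm (of_real (mellin_weight s t) * D t)) = A t * B t"
    proof (cases "t > 0")
      case True
      have "(s - 3/4) / 2 + (s - 5/4) / 2 = s - 1" by (simp add: field_simps)
      hence "t powr ((s - 3/4) / 2) * t powr ((s - 5/4) / 2) = t powr (s - 1)"
        by (simp only: powr_add[symmetric])
      moreover have "exp (t / 4) * exp (- t / 4) = 1" by (simp flip: exp_add)
      ultimately have "(t powr ((s - 3/4) / 2) * t powr ((s - 5/4) / 2)) * (exp (t / 4) * exp (- t / 4)) * norm (D t) = t powr (s - 1) * norm (D t)"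
        by (simp only: mult_1_right)
      hence "(t powr ((s - 3/4) / 2) * exp (t / 4) * norm (D t)) * (t powr ((s - 5/4) / 2) * exp (- t / 4)) = t powr (s - 1) * norm (D t)"
        by (simp only: mult_ac)
      moreover have "A t * B t = ennreal ((t powr ((s - 3/4) / 2) * exp (t / 4) * norm (D t)) * (t powr ((s - 5/4) / 2) * exp (- t / 4)))"
        using True unfolding A_def B_def by (simp add: ennreal_mult)
      ultimately have "A t * B t = ennreal (t powr (s - 1) * norm (D t))" by (simp only:)
      thus ?thesis using True by (simp add: mellin_weight_def norm_mult)
    qed (simp add: mellin_weight_def A_def B_def)
  qed
  finally have "(ennreal (norm I))\<^sup>2 \<le> (\<integral>\<^sup>+t. A t * B t \<partial>lborel)\<^sup>2" by (intro power_mono) auto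
  also have "\<dots> \<le> (\<integral>\<^sup>+t. (A t)\<^sup>2 \<partial>lborel) * (\<integral>\<^sup>+t. (B t)\<^sup>2 \<partial>lborel)"
    by (intro Cauchy_Schwarz_nn_integral) measurable
  also have "(\<integral>\<^sup>+t. (A t)\<^sup>2 \<partial>lborel) = (\<integral>\<^sup>+t. ennreal (indicator {0<..} t * (t powr (s - 3/4) * exp (t / 2)) * (norm (D t))\<^sup>2) \<partial>lborel)"
  proof (intro nn_integral_cong)
    fix t :: real
    have "(t powr ((s - 3/4) / 2))\<^sup>2 = t powr (s - 3/4)" if "t > 0"
      using that by (simp add: power2_eq_square flip: powr_add)
    moreover have "(exp (t / 4))\<^sup>2 = exp (t / 2)" by (simp flip: exp_double)
    ultimately show "(A t)\<^sup>2 = ennreal (indicator {0<..} t * (t powr (s - 3/4) * exp (t / 2)) * (norm (D t))\<^sup>2)"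
      unfolding A_def by (cases "t > 0") (simp_all add: ennreal_power power_mult_distrib)
  qed
  also have "(\<integral>\<^sup>+t. (B t)\<^sup>2 \<partial>lborel) = (\<integral>\<^sup>+t. ennreal (indicator {0<..} t * (t powr ((s - 1/4) - 1) * exp (- (1/2) * t))) \<partial>lborel)"
  proof (intro nn_integral_cong)
    fix t :: real
    have "(t powr ((s - 5/4) / 2))\<^sup>2 = t powr ((s - 1/4) - 1)" if "t > 0"
      using that by (simp add: power2_eq_square flip: powr_add)
    moreover have "(exp (- t / 4))\<^sup>2 = exp (- (1/2) * t)" by (simp flip: exp_double)
    ultimately show "(B t)\<^sup>2 = ennreal (indicator {0<..} t * (t powr ((s - 1/4) - 1) * exp (- (1/2) * t)))"
      unfolding B_def by (cases "t > 0") (simp_all add: ennreal_power power_mult_distrib)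
  qed
  also have "\<dots> = ennreal (Gamma (s - 1/4) / (1/2) powr (s - 1/4))"
    using assms by (intro nn_integral_gamma_weight) auto
  finally have "ennreal (1 / (Gamma s)\<^sup>2) * (ennreal (norm I))\<^sup>2 \<le> ennreal (1 / (Gamma s)\<^sup>2) *
      ((\<integral>\<^sup>+t. ennreal (indicator {0<..} t * (t powr (s - 3/4) * exp (t / 2)) * (norm (D t))\<^sup>2) \<partial>lborel) * ennreal (Gamma (s - 1/4) / (1/2) powr (s - 1/4)))"
    by (intro mult_left_mono) auto
  also have "\<dots> = (ennreal (1 / (Gamma s)\<^sup>2) * ennreal (Gamma (s - 1/4) / (1/2) powr (s - 1/4))) *
      (\<integral>\<^sup>+t. ennreal (indicator {0<..} t * (t powr (s - 3/4) * exp (t / 2)) * (norm (D t))\<^sup>2) \<partial>lborel)"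
    by (simp only: mult_ac)
  also have "ennreal (1 / (Gamma s)\<^sup>2) * ennreal (Gamma (s - 1/4) / (1/2) powr (s - 1/4)) = ennreal c"
    unfolding c_def by (subst ennreal_mult'[symmetric]) (auto simp: mult.commute)
  finally show ?thesis unfolding 1 D_def .
qed

section \<open>Weak type\<close>

text \<open>After Cauchy-Schwarz, Fubini brings the integral over x inside. For fixed t that inner
  integral \<open>J N t\<close> tends to 0, and Bessel's inequality bounds it independently of N, so
  dominated convergence applies in t.\<close>

lemma m_partial_tendsto_m_fun:
  assumes "s > 1/4"
  shows "(\<lambda>N. \<integral>\<^sup>+x\<in>{0..1}. ennreal ((norm (m_partial s N x - m_fun s x))\<^sup>2) \<partial>lborel) \<longlonglongrightarrow> 0"
proof -
  obtain C where C: "C > 0"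
    "\<And>x t. t > 0 \<Longrightarrow> norm (euler_dev x t) \<le> C * (t powr (-1/4) * exp (- t / 2))"
    using euler_fun_bound unfolding euler_dev_def by blast
  define c where "c = Gamma (s - 1/4) / (1/2) powr (s - 1/4) / (Gamma s)\<^sup>2"
  define v where "v t = indicator {0<..} t * (t powr (s - 3/4) * exp (t / 2))" for t :: real
  have v0: "v t \<ge> 0" for t by (simp add: v_def)
  have [measurable]: "v \<in> borel_measurable lborel" unfolding v_def by measurable
  define D where "D N x t = (norm (euler_dev x t - dev_sum {1..N} x t))\<^sup>2" for N x t
  have D0: "D N x t \<ge> 0" for N x t by (simp add: D_def)
  have [measurable]: "case_prod (D N) \<in> borel_measurable (lborel \<Otimes>\<^sub>M lborel)" for N
    unfolding D_def by measurable
  define J where "J N t = (\<integral>\<^sup>+x. ennreal (indicator {0..1} x * D N x t) \<partial>lborel)" for N t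
  have [measurable]: "J N \<in> borel_measurable lborel" for N unfolding J_def by measurable
  \<comment> \<open>This is \<open>v\<close> times the squared bound of
    \<open>euler_fun_bound\<close>: t^(s-3/4) t^(-1/2) = t^(s-5/4) and exp(t/2) exp(-t) =
    exp(-t/2).\<close>
  define w where "w t = ennreal (C\<^sup>2) * ennreal (indicator {0<..} t * (t powr ((s - 1/4) - 1) * exp (- (1/2) * t)))" for t :: real
  have [measurable]: "w \<in> borel_measurable lborel" unfolding w_def by measurable

  have le: "(\<integral>\<^sup>+x\<in>{0..1}. ennreal ((norm (m_partial s N x - m_fun s x))\<^sup>2) \<partial>lborel)
      \<le> ennreal c * (\<integral>\<^sup>+t. ennreal (v t) * J N t \<partial>lborel)" for N
  proof -
    have "(\<integral>\<^sup>+x\<in>{0..1}. ennreal ((norm (m_partial s N x - m_fun s x))\<^sup>2) \<partial>lborel)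
      \<le> (\<integral>\<^sup>+x\<in>{0..1}. (ennreal c * (\<integral>\<^sup>+t. ennreal (v t * D N x t) \<partial>lborel)) \<partial>lborel)"
      unfolding c_def v_def D_def by (intro nn_integral_mono mult_right_mono m_partial_minus_m_fun_le assms) auto
    also have "\<dots> = (\<integral>\<^sup>+x. ennreal c * (\<integral>\<^sup>+t. ennreal (v t) * ennreal (indicator {0..1} x * D N x t) \<partial>lborel) \<partial>lborel)"
    proof (intro nn_integral_cong)
      fix x :: real
      show "ennreal c * (\<integral>\<^sup>+t. ennreal (v t * D N x t) \<partial>lborel) * indicator {0..1} x =
        ennreal c * (\<integral>\<^sup>+t. ennreal (v t) * ennreal (indicator {0..1} x * D N x t) \<partial>lborel)"
        using v0 D0 by (cases "x \<in> {0..1}") (simp_all add: ennreal_mult)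
    qed
    also have "\<dots> = ennreal c * (\<integral>\<^sup>+x. (\<integral>\<^sup>+t. ennreal (v t) * ennreal (indicator {0..1} x * D N x t) \<partial>lborel) \<partial>lborel)"
      by (intro nn_integral_cmult) measurable
    also have "(\<integral>\<^sup>+x. (\<integral>\<^sup>+t. ennreal (v t) * ennreal (indicator {0..1} x * D N x t) \<partial>lborel) \<partial>lborel)
        = (\<integral>\<^sup>+t. (\<integral>\<^sup>+x. ennreal (v t) * ennreal (indicator {0..1} x * D N x t) \<partial>lborel) \<partial>lborel)"
      by (rule lborel_pair.Fubini'[symmetric]) measurable
    also have "\<dots> = (\<integral>\<^sup>+t. ennreal (v t) * J N t \<partial>lborel)"
      unfolding J_def by (intro nn_integral_cong nn_integral_cmult) measurable
    finally show ?thesis .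
  qed

  have "(\<lambda>N. \<integral>\<^sup>+t. ennreal (v t) * J N t \<partial>lborel) \<longlonglongrightarrow> (\<integral>\<^sup>+t. (0 :: ennreal) \<partial>(lborel :: real measure))"
  proof (rule nn_integral_dominated_convergence[where w = w])
    show "(\<integral>\<^sup>+t. w t \<partial>lborel) < \<infinity>"
    proof -
      have "(\<integral>\<^sup>+t. w t \<partial>lborel) = ennreal (C\<^sup>2) * (\<integral>\<^sup>+t. ennreal (indicator {0<..} t * (t powr ((s - 1/4) - 1) * exp (- (1/2) * t))) \<partial>lborel)"
        unfolding w_def by (intro nn_integral_cmult) measurable
      also have "\<dots> = ennreal (C\<^sup>2) * ennreal (Gamma (s - 1/4) / (1/2) powr (s - 1/4))"
        using assms by (subst nn_integral_gamma_weight) auto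
      also have "\<dots> < \<infinity>" by (simp add: ennreal_mult_less_top)
      finally show ?thesis .
    qed
    show "AE t in lborel. (\<lambda>N. ennreal (v t) * J N t) \<longlonglongrightarrow> 0"
    proof (intro AE_I2)
      fix t :: real
      show "(\<lambda>N. ennreal (v t) * J N t) \<longlonglongrightarrow> 0"
      proof (cases "t > 0")
        case True
        have "(\<lambda>N. J N t) \<longlonglongrightarrow> 0"
          unfolding J_def D_def by (rule nn_integral_dev_sum_diff_tendsto_0[OF True])
        hence "(\<lambda>N. ennreal (v t) * J N t) \<longlonglongrightarrow> ennreal (v t) * 0"
          by (intro ennreal_tendsto_cmult) auto
        thus ?thesis by simp
      qed (simp add: v_def)
    qed
    show "AE t in lborel. ennreal (v t) * J N t \<le> w t" for N
    proof (intro AE_I2)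
      fix t :: real
      show "ennreal (v t) * J N t \<le> w t"
      proof (cases "t > 0")
        case True
        define M where "M = C * (t powr (-1/4) * exp (- t / 2))"
        have "J N t \<le> (\<integral>\<^sup>+x. ennreal (indicator {0..1} x * (norm (euler_dev x t))\<^sup>2) \<partial>lborel)"
          unfolding J_def D_def by (rule nn_integral_dev_sum_diff_le[OF True])
        also have "\<dots> \<le> (\<integral>\<^sup>+x. ennreal (M\<^sup>2) * indicator {0..1::real} x \<partial>lborel)"
        proof (rule nn_integral_mono)
          fix x :: real
          have "(norm (euler_dev x t))\<^sup>2 \<le> M\<^sup>2"
            using C(2)[OF True, of x] unfolding M_def by (intro power_mono) auto
          thus "ennreal (indicator {0..1} x * (norm (euler_dev x t))\<^sup>2) \<le> ennreal (M\<^sup>2) * indicator {0..1} x"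
            by (auto simp: indicator_def intro!: ennreal_leI)
        qed
        also have "\<dots> = ennreal (M\<^sup>2)" by (subst nn_integral_cmult_indicator) auto
        finally have "ennreal (v t) * J N t \<le> ennreal (v t) * ennreal (M\<^sup>2)"
          by (intro mult_left_mono) auto
        also have "\<dots> = ennreal (v t * M\<^sup>2)" using v0 by (simp add: ennreal_mult)
        also have "v t * M\<^sup>2 = C\<^sup>2 * (t powr ((s - 1/4) - 1) * exp (- (1/2) * t))"
        proof -
          have "M\<^sup>2 = C\<^sup>2 * (t powr (-1/2) * exp (- t))"
            using True by (simp add: M_def power_mult_distrib powr_power flip: exp_double)
          hence "v t * M\<^sup>2 = C\<^sup>2 * ((t powr (s - 3/4) * t powr (-1/2)) * (exp (t / 2) * exp (- t)))"
            using True by (simp add: v_def mult_ac)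
          also have "t powr (s - 3/4) * t powr (-1/2) = t powr ((s - 1/4) - 1)"
          proof -
            have "(s - 3/4) + (-1/2) = (s - 1/4) - 1" by simp
            thus ?thesis by (simp only: powr_add[symmetric])
          qed
          also have "exp (t / 2) * exp (- t) = exp (- (1/2) * t)" by (simp flip: exp_add)
          finally show ?thesis .
        qed
        also have "ennreal \<dots> = w t" using True unfolding w_def by (simp add: ennreal_mult)
        finally show ?thesis .
      qed (simp add: v_def)
    qed
  qed measurable
  hence "(\<lambda>N. ennreal c * (\<integral>\<^sup>+t. ennreal (v t) * J N t \<partial>lborel)) \<longlonglongrightarrow> ennreal c * 0"
    by (intro ennreal_tendsto_cmult) auto
  hence "(\<lambda>N. ennreal c * (\<integral>\<^sup>+t. ennreal (v t) * J N t \<partial>lborel)) \<longlonglongrightarrow> 0" by simp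
  thus ?thesis
    by (rule tendsto_sandwich[OF _ _ tendsto_const, rotated 2]) (use le in auto)
qed

section \<open>From one bounded representative to all of them\<close>

lemma is_m_sf_m_fun:
  assumes "s > 1/4"
  shows "is_m_sf s (m_fun s)"
  unfolding is_m_sf_def using m_partial_tendsto_m_fun[OF assms] by auto

text \<open>Uniqueness of limits in L^2, via |g - h|^2 <= 2|m - g|^2 + 2|m - h|^2 with m a partial
  sum. It carries the bound of \<open>m_fun\<close> over to any representative, up to a null
  set.\<close>

lemma is_m_sf_unique_AE:
  assumes "is_m_sf s g" "is_m_sf s h"
  shows "AE x in lborel. x \<in> {0..1} \<longrightarrow> g x = h x"
proof -
  have [measurable]: "g \<in> borel_measurable lborel" "h \<in> borel_measurable lborel"
    using assms by (auto simp: is_m_sf_def)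
  have [measurable]: "m_partial s N \<in> borel_measurable lborel" for N
    unfolding m_partial_def by measurable
  let ?d = "\<lambda>g N. \<integral>\<^sup>+x\<in>{0..1}. ennreal ((norm (m_partial s N x - g x))\<^sup>2) \<partial>lborel"
  let ?I = "\<integral>\<^sup>+x\<in>{0..1}. ennreal ((norm (g x - h x))\<^sup>2) \<partial>lborel"
  have "?I \<le> 2 * ?d g N + 2 * ?d h N" for N
  proof -
    have "?I \<le> (\<integral>\<^sup>+x. 2 * (ennreal ((norm (m_partial s N x - g x))\<^sup>2) * indicator {0..1} x)
             + 2 * (ennreal ((norm (m_partial s N x - h x))\<^sup>2) * indicator {0..1} x) \<partial>lborel)"
    proof (rule nn_integral_mono)
      fix x :: real
      let ?a = "norm (m_partial s N x - g x)" and ?b = "norm (m_partial s N x - h x)"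
      have "norm (g x - h x) \<le> ?a + ?b"
        using norm_triangle_ineq4[of "m_partial s N x - h x" "m_partial s N x - g x"] by (simp add: algebra_simps)
      hence "(norm (g x - h x))\<^sup>2 \<le> (?a + ?b)\<^sup>2" by (intro power_mono) auto
      also have "\<dots> \<le> 2 * ?a\<^sup>2 + 2 * ?b\<^sup>2"
        using zero_le_power2[of "?a - ?b"] by (simp add: power2_eq_square algebra_simps)
      finally have "ennreal ((norm (g x - h x))\<^sup>2) \<le> ennreal (2 * ?a\<^sup>2 + 2 * ?b\<^sup>2)" by (rule ennreal_leI)
      also have "\<dots> = 2 * ennreal (?a\<^sup>2) + 2 * ennreal (?b\<^sup>2)"
        by (simp add: ennreal_plus ennreal_mult)
      finally show "ennreal ((norm (g x - h x))\<^sup>2) * indicator {0..1} x \<le>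
         2 * (ennreal (?a\<^sup>2) * indicator {0..1} x) + 2 * (ennreal (?b\<^sup>2) * indicator {0..1} x)"
        by (cases "x \<in> {0..1}") auto
    qed
    also have "\<dots> = 2 * ?d g N + 2 * ?d h N"
      by (subst nn_integral_add) (auto simp: nn_integral_cmult)
    finally show ?thesis .
  qed
  moreover have "(\<lambda>N. 2 * ?d g N + 2 * ?d h N) \<longlonglongrightarrow> 2 * 0 + 2 * 0"
    using assms unfolding is_m_sf_def by (intro tendsto_add ennreal_tendsto_cmult) auto
  ultimately have "?I \<le> 2 * 0 + 2 * 0"
    by (intro LIMSEQ_le_const) auto
  hence "?I = 0" by simp
  hence "AE x in lborel. ennreal ((norm (g x - h x))\<^sup>2) * indicator {0..1} x = 0"
    by (subst (asm) nn_integral_0_iff_AE) auto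
  thus ?thesis by eventually_elim (auto simp: indicator_def split: if_splits)
qed

text \<open>For alpha >= B the level set is null. For alpha < B its measure is at most 1, which is
  at most (B / alpha)^r.\<close>

lemma weak_type_L_if_AE_bounded:
  assumes [measurable]: "h \<in> borel_measurable lborel"
    and B: "B > 0" "AE x in lborel. x \<in> {0..1} \<longrightarrow> norm (h x) \<le> B"
    and r: "r \<ge> 0"
  shows "weak_type_L r h"
  unfolding weak_type_L_def
proof (intro exI allI impI)
  fix \<alpha> :: real assume \<alpha>: "\<alpha> > 0"
  have [measurable]: "{x \<in> {0..1}. cmod (h x) > \<alpha>} \<in> sets lborel" by measurable
  show "emeasure lborel {x\<in>{0..1}. cmod (h x) > \<alpha>} \<le> ennreal (B powr r * \<alpha> powr (- r))"
  proof (cases "\<alpha> \<ge> B")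
    case True
    have "AE x in lborel. x \<notin> {x\<in>{0..1}. cmod (h x) > \<alpha>}"
      using B(2) by eventually_elim (use True in auto)
    hence "{x\<in>{0..1}. cmod (h x) > \<alpha>} \<in> null_sets lborel"
      by (subst AE_iff_null_sets) auto
    hence "emeasure lborel {x\<in>{0..1}. cmod (h x) > \<alpha>} = 0" by (rule null_setsD1)
    thus ?thesis by simp
  next
    case False
    have "emeasure lborel {x\<in>{0..1}. cmod (h x) > \<alpha>} \<le> emeasure lborel {0..1::real}"
      by (intro emeasure_mono) auto
    also have "\<dots> = ennreal 1" by simp
    also have "\<dots> \<le> ennreal (B powr r * \<alpha> powr (- r))"
    proof (rule ennreal_leI)
      have "1 \<le> (B / \<alpha>) powr r" using False \<alpha> B r by (intro ge_one_powr_ge_zero) auto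
      also have "\<dots> = B powr r * \<alpha> powr (- r)" using \<alpha> B by (simp add: powr_divide powr_minus field_simps)
      finally show "1 \<le> B powr r * \<alpha> powr (- r)" .
    qed
    finally show ?thesis .
  qed
qed

theorem theorem2:
  fixes s :: real
  assumes "1/4 < s" and "s < 1/2"
  shows "(\<exists>g. is_m_sf s g) \<and> (\<forall>h.  is_m_sf s h \<longrightarrow> weak_type_L (2 / (1 - 2 * s)) h)"
proof (intro conjI allI impI)
  show "\<exists>g. is_m_sf s g" using is_m_sf_m_fun[OF assms(1)] by blast
  fix h assume h: "is_m_sf s h"
  obtain B where B: "B > 0" "\<And>x. norm (m_fun s x) \<le> B"
    using m_fun_bounded[OF assms(1)] by blast
  show "weak_type_L (2 / (1 - 2 * s)) h"
  proof (rule weak_type_L_if_AE_bounded)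
    show "h \<in> borel_measurable lborel" using h by (simp add: is_m_sf_def)
    show "AE x in lborel. x \<in> {0..1} \<longrightarrow> norm (h x) \<le> B"
      using is_m_sf_unique_AE[OF is_m_sf_m_fun[OF assms(1)] h] by eventually_elim (metis B(2))
  \<comment> \<open>Here \<open>s < 1/2\<close> makes the exponent 2 / (1 - 2s) positive.\<close>
  qed (use B assms in auto)
qed

end
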